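(* Let $j_1,j_2$ be join-irreducible elements of the weak order on $B_n$. Then $j_1$ forces $j_2$ if and only if the type-B arc corresponding to $j_1$ is a subarc of the type-B arc corresponding to $j_2$.
   Context: $B_n$: signed permutations of $\{\pm1,\ldots,\pm n\}$ ($\pi(-i)=-\pi(i)$), long one-line notation $\pi_{-n}\cdots\pi_{-1}\pi_1\cdots\pi_n$. Weak order: $\sigma$ covers $\pi$ iff either $\pi_{-1}<\pi_1$ and $\sigma$ swaps $\pi_{-1},\pi_1$, or $\pi_i<\pi_{i+1}$ ($1\le i\le n-1$) and $\sigma$ swaps $\pi_i,\pi_{i+1}$ and $\pi_{-i-1},\pi_{-i}$; a finite lattice. $j$ join-irreducible: covers exactly one element $j_*$. A lattice congruence is an equivalence relation compatible with $\wedge,\vee$; it contracts $j$ if $j\equiv j_*$. $j_1$ forces $j_2$ if every congruence contracting $j_1$ contracts $j_2$. Symmetric model: $2n$ points labeled $-n,\ldots,-1,1,\ldots,n$ bottom to top on a vertical line, symmetric under $x\mapsto -x$. For $\pi\in B_n$, $\delta(\pi)$ has, for each pair of consecutive positions $a,b$ (order $-n<\cdots<-1<1<\cdots<n$) with $\pi_a>\pi_b$, an arc (monotone downward curve avoiding other labeled points) from $\pi_a$ to $\pi_b$ passing right of each $\pi_c$ with $\pi_b<\pi_c<\pi_a$, $c$ before $a$, and left of such $\pi_c$ with $c$ after $b$. Orbifold model: the orbifold plane is $\mathbb R^2/(x\sim-x)$, pictured as the open upper half-plane plus, for each $r\ge0$, a semicircle point (closed lower semicircle of radius $r$; $r=0$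 is the orbifold point $\times$); numbered points $1,\ldots,n$ lie above $\times$ on the vertical axis, increasing upward. Type-B arcs (up to combinatorial equivalence): an ordinary arc goes monotone downward from numbered $q$ to numbered $p<q$, passing left or right of each point between; an orbifold arc goes monotone downward from numbered $p$ to $\times$, passing left or right of each of $1,\ldots,p-1$; a long arc contains exactly one semicircle point, not $\times$, and consists of a left piece descending from its left endpoint $p$ and a right piece descending from its right endpoint $q\ne p$, disjoint, each passing left or right of the points below its endpoint. For ordinary/orbifold $\alpha$ with endpoints $p<q$ (with $\times=0$), $L(\alpha)$, $R(\alpha)$ are the numbered points strictly between lying left/right of $\alpha$. For long $\alpha$ with left endpoint $p$, right endpoint $q$: $L(\alpha)$ = points in $(0,p)$ left of the left piece, $R(\alpha)$ = points in $(0,q)$ right of the right piece; these are disjoint, and the remaining points of $(0,\min(p,q))$ lie between the pieces. $\phi$ maps points above the horizontal axis to themselves, points below to their negatives, and a point $x$ on the axis to the semicircle point of radius $|x|$; $\delta^\circ(\pi)=\phi(\delta(\pi))$. For join-irreducible $j$, $\delta^\circ(j)$ is a single type-B arc, "the arc corresponding to $j$" (a bijection). Subarcs: If $\alpha$ is ordinary or orbifold with endpoints $p<q$ ($\times=0$), a subarc is an arc $\alpha'$ with endpoints $p\le p'<q'\le q$ and $R(\alpha')=R(\alpha)\cap(p',q')$ (ordinary unless $p'=0$, then orbifold). If $\alpha$ is long with left endpoint $p$, right endpoint $q$: an ordinary $\alpha'$ with endpoints $p'<q'$ is a subarc iff either $q'\le p$ and $L(\alpha')=L(\alpha)\cap(p',q')$,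 or $q'\le q$ and $R(\alpha')=R(\alpha)\cap(p',q')$; an orbifold $\alpha'$ with upper endpoint $p'$ is a subarc iff $p'\le\min(p,q)$, $L(\alpha')=L(\alpha)\cap(0,p')$, $R(\alpha')=R(\alpha)\cap(0,p')$; a long $\alpha'$ with left endpoint $p'$ and right endpoint $q'$ is a subarc iff $p'\le p$, $q'\le q$, $L(\alpha')=L(\alpha)\cap(0,p')$, $R(\alpha')=R(\alpha)\cap(0,q')$, $p'\notin R(\alpha)$ and $q'\notin L(\alpha)$.
   Formalization: For a long α' in a long α, subarc is taken with p' ∉ R(α') and q' ∉ L(α') instead of p' ∉ R(α) and q' ∉ L(α); with the original clause the subarc relation is not transitive for n ≥ 4, while forcing is, so the claim would fail. *)

theory Defs
  imports "HOL-Algebra.Lattice" "HOL-Combinatorics.Permutations"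
begin

text \<open>
  A signed permutation is a function on all of \<open>int\<close> that is the identity off
  \<open>{-n..n} - {0}\<close>; in particular \<open>\<pi> 0 = 0\<close>.
\<close>

definition signed_perms :: "nat \<Rightarrow> (int \<Rightarrow> int) set" where
  "signed_perms n =
     {\<pi>. \<pi> permutes ({- int n..int n} - {0}) \<and> (\<forall>i. \<pi> (- i) = - \<pi> i)}"

text \<open>Swapping entries of the one-line notation is composition on the right.\<close>

definition weak_covered :: "nat \<Rightarrow> (int \<Rightarrow> int) \<Rightarrow> (int \<Rightarrow> int) \<Rightarrow> bool" where
  "weak_covered n \<pi> \<sigma> \<longleftrightarrow> \<pi> \<in> signed_perms n \<and> \<sigma> \<in> signed_perms n \<and>
     ((1 \<le> n \<and> \<pi> (- 1) < \<pi> 1 \<and> \<sigma> = \<pi> \<circ> transpose (- 1) 1) \<or>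
      (\<exists>i. 1 \<le> i \<and> i \<le> int n - 1 \<and> \<pi> i < \<pi> (i + 1) \<and>
           \<sigma> = \<pi> \<circ> transpose i (i + 1) \<circ> transpose (- i - 1) (- i)))"

definition weak_order :: "nat \<Rightarrow> (int \<Rightarrow> int) gorder" where
  "weak_order n = \<lparr>carrier = signed_perms n, eq = (=), le = (weak_covered n)\<^sup>*\<^sup>*\<rparr>"

definition join_irreducible :: "nat \<Rightarrow> (int \<Rightarrow> int) \<Rightarrow> bool" where
  "join_irreducible n j \<longleftrightarrow> j \<in> signed_perms n \<and> (\<exists>!\<pi>. weak_covered n \<pi> j)"

definition lower_cover :: "nat \<Rightarrow> (int \<Rightarrow> int) \<Rightarrow> (int \<Rightarrow> int)" where
  "lower_cover n j = (THE \<pi>. weak_covered n \<pi> j)"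

definition lattice_congruence :: "('a, 'b) gorder_scheme \<Rightarrow> ('a \<times> 'a) set \<Rightarrow> bool" where
  "lattice_congruence L \<theta> \<longleftrightarrow> equiv (carrier L) \<theta> \<and>
     (\<forall>x x' y y'. (x, x') \<in> \<theta> \<longrightarrow> (y, y') \<in> \<theta> \<longrightarrow>
        (x \<squnion>\<^bsub>L\<^esub> y, x' \<squnion>\<^bsub>L\<^esub> y') \<in> \<theta> \<and> (x \<sqinter>\<^bsub>L\<^esub> y, x' \<sqinter>\<^bsub>L\<^esub> y') \<in> \<theta>)"

definition contracts :: "nat \<Rightarrow> ((int \<Rightarrow> int) \<times> (int \<Rightarrow> int)) set \<Rightarrow> (int \<Rightarrow> int) \<Rightarrow> bool" where
  "contracts n \<theta> j \<longleftrightarrow> (j, lower_cover n j) \<in> \<theta>"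

definition forces :: "nat \<Rightarrow> (int \<Rightarrow> int) \<Rightarrow> (int \<Rightarrow> int) \<Rightarrow> bool" where
  "forces n j\<^sub>1 j\<^sub>2 \<longleftrightarrow>
     (\<forall>\<theta>. lattice_congruence (weak_order n) \<theta> \<longrightarrow> contracts n \<theta> j\<^sub>1 \<longrightarrow> contracts n \<theta> j\<^sub>2)"

text \<open>
  An arc of the symmetric model up to combinatorial equivalence: its upper and lower endpoints
  and the sets of points at heights strictly between them that lie to its left, respectively to
  its right. Besides the labeled points, these sets also record the origin, as \<open>0\<close>: it lies to
  the left (right) of the arc iff the arc meets the horizontal axis at some \<open>x > 0\<close> (\<open>x < 0\<close>),
  and \<open>0\<close> is in neither set if the arc runs through the origin.
\<close>

datatype sym_arc = Sym_Arc (upper: int) (lower: int) (lefts: "int set") (rights: "int set")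

definition next_pos :: "int \<Rightarrow> int" where
  "next_pos a = (if a = - 1 then 1 else a + 1)"

text \<open>
  In the two sets below \<open>c = 0\<close> contributes \<open>\<pi> 0 = 0\<close>, which places the origin. This is forced by
  the drawing: an arc \<open>\<alpha>\<close> from \<open>\<pi> a > 0\<close> to \<open>\<pi> b < 0\<close> with \<open>0 < a\<close> passes to the right of every
  \<open>\<pi> c\<close> of intermediate height with \<open>c < 0\<close>, among them an endpoint of its mirror image \<open>- \<alpha>\<close>
  (the arc for positions \<open>- b\<close>, \<open>- a\<close>). The two arcs do not cross, so \<open>\<alpha>\<close> runs to the right of
  \<open>- \<alpha>\<close> and hence of the origin. Symmetrically for \<open>b < 0\<close>; for \<open>a = - 1\<close>, \<open>b = 1\<close> the arc is its
  own mirror image and runs through the origin.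
\<close>

definition descent_arc :: "(int \<Rightarrow> int) \<Rightarrow> int \<Rightarrow> sym_arc" where
  "descent_arc \<pi> a = (let b = next_pos a in
     Sym_Arc (\<pi> a) (\<pi> b)
       {\<pi> c | c. c < a \<and> \<pi> b < \<pi> c \<and> \<pi> c < \<pi> a}
       {\<pi> c | c. b < c \<and> \<pi> b < \<pi> c \<and> \<pi> c < \<pi> a})"

definition delta :: "nat \<Rightarrow> (int \<Rightarrow> int) \<Rightarrow> sym_arc set" where
  "delta n \<pi> =
     descent_arc \<pi> ` {a. - int n \<le> a \<and> a < int n \<and> a \<noteq> 0 \<and> \<pi> a > \<pi> (next_pos a)}"

text \<open>
  Type-B arcs up to combinatorial equivalence; the orbifold point is \<open>0\<close>.
  \<open>Ordinary p q R\<close> has lower endpoint \<open>p\<close> and upper endpoint \<open>q\<close>, \<open>Orbifold q R\<close> runs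
  from \<open>q\<close> down to the orbifold point, and in both cases \<open>R\<close> is the set of points lying right of
  the arc. \<open>Long p q L R\<close> has left endpoint \<open>p\<close> and right endpoint \<open>q\<close>, \<open>L\<close> is the set of
  points left of the left piece and \<open>R\<close> the set of points right of the right piece.
\<close>

datatype typeB_arc =
    Ordinary int int "int set"
  | Orbifold int "int set"
  | Long int int "int set" "int set"

text \<open>
  For long arcs the last two conditions hold because the pieces are disjoint: if \<open>p < q\<close>, then \<open>p\<close>,
  being an endpoint of the left piece, is left of the right piece, and dually if \<open>q < p\<close>.
\<close>

fun is_typeB_arc :: "nat \<Rightarrow> typeB_arc \<Rightarrow> bool" where
  "is_typeB_arc n (Ordinary p q R) \<longleftrightarrow> 0 < p \<and> p < q \<and> q \<le> int n \<and> R \<subseteq> {p<..<q}"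
| "is_typeB_arc n (Orbifold q R) \<longleftrightarrow> 0 < q \<and> q \<le> int n \<and> R \<subseteq> {0<..<q}"
| "is_typeB_arc n (Long p q L R) \<longleftrightarrow>
     0 < p \<and> p \<le> int n \<and> 0 < q \<and> q \<le> int n \<and> p \<noteq> q \<and>
     L \<subseteq> {0<..<p} \<and> R \<subseteq> {0<..<q} \<and> L \<inter> R = {} \<and> p \<notin> R \<and> q \<notin> L"

fun left_points :: "typeB_arc \<Rightarrow> int set" where
  "left_points (Ordinary p q R) = {p<..<q} - R"
| "left_points (Orbifold q R) = {0<..<q} - R"
| "left_points (Long p q L R) = L"

fun right_points :: "typeB_arc \<Rightarrow> int set" where
  "right_points (Ordinary p q R) = R"
| "right_points (Orbifold q R) = R"
| "right_points (Long p q L R) = R"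

text \<open>
  The part of an arc below the horizontal axis is rotated by a half turn, which exchanges left
  and right. An arc crossing the axis at \<open>x > 0\<close> has its upper part end at the right end of the
  semicircle of radius \<open>x\<close> (the right piece) and its rotated lower part at the left end (the left
  piece); for \<open>x < 0\<close> it is the other way round. An arc of \<open>delta n \<pi>\<close> through the origin is
  centrally symmetric, so its two halves have the same image.
\<close>

definition phi :: "sym_arc \<Rightarrow> typeB_arc" where
  "phi \<alpha> =
    (if 0 < lower \<alpha> then Ordinary (lower \<alpha>) (upper \<alpha>) (rights \<alpha>)
     else if upper \<alpha> < 0 then Ordinary (- upper \<alpha>) (- lower \<alpha>) (uminus ` lefts \<alpha>)
     else if 0 \<in> lefts \<alpha> then
       Long (- lower \<alpha>) (upper \<alpha>) (uminus ` (rights \<alpha> \<inter> {..<0})) (rights \<alpha> \<inter> {0<..})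
     else if 0 \<in> rights \<alpha> then
       Long (upper \<alpha>) (- lower \<alpha>) (lefts \<alpha> \<inter> {0<..}) (uminus ` (lefts \<alpha> \<inter> {..<0}))
     else Orbifold (upper \<alpha>) (rights \<alpha> \<inter> {0<..}))"

definition delta_orb :: "nat \<Rightarrow> (int \<Rightarrow> int) \<Rightarrow> typeB_arc set" where
  "delta_orb n \<pi> = phi ` delta n \<pi>"

text \<open>Only meant for join-irreducible \<open>j\<close>, where \<open>delta_orb n j\<close> is a singleton.\<close>

definition arc_of :: "nat \<Rightarrow> (int \<Rightarrow> int) \<Rightarrow> typeB_arc" where
  "arc_of n j = the_elem (delta_orb n j)"

text \<open>
  In the clause for two long arcs, the conditions \<open>p' \<notin> R'\<close> and \<open>q' \<notin> L'\<close> say that the truncated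
  pieces again form a long arc. The source states this clause with \<open>p' \<notin> R\<close> and \<open>q' \<notin> L\<close>. That
  differs from the clause below only if, say, \<open>p' \<in> R\<close> and \<open>q' < p'\<close>, so that the truncated right
  piece ends before it reaches the height of \<open>p'\<close>; and with it subarcs would not be transitive,
  whereas forcing is: \<open>Long 2 1 {} {}\<close> would be a subarc of \<open>Long 4 1 {} {}\<close>, and that one of
  \<open>Long 4 3 {} {2}\<close>, but the first would not be a subarc of the last.
\<close>

fun subarc_cond :: "typeB_arc \<Rightarrow> typeB_arc \<Rightarrow> bool" where
  "subarc_cond (Ordinary p' q' R') (Ordinary p q R) \<longleftrightarrow>
     p \<le> p' \<and> p' < q' \<and> q' \<le> q \<and> R' = R \<inter> {p'<..<q'}"
| "subarc_cond (Ordinary p' q' R') (Orbifold q R) \<longleftrightarrow>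
     0 < p' \<and> p' < q' \<and> q' \<le> q \<and> R' = R \<inter> {p'<..<q'}"
| "subarc_cond (Orbifold q' R') (Orbifold q R) \<longleftrightarrow>
     0 < q' \<and> q' \<le> q \<and> R' = R \<inter> {0<..<q'}"
| "subarc_cond (Orbifold q' R') (Ordinary p q R) \<longleftrightarrow> False"
| "subarc_cond (Long p' q' L' R') (Ordinary p q R) \<longleftrightarrow> False"
| "subarc_cond (Long p' q' L' R') (Orbifold q R) \<longleftrightarrow> False"
| "subarc_cond (Ordinary p' q' R') (Long p q L R) \<longleftrightarrow>
     (q' \<le> p \<and> left_points (Ordinary p' q' R') = L \<inter> {p'<..<q'}) \<or>
     (q' \<le> q \<and> right_points (Ordinary p' q' R') = R \<inter> {p'<..<q'})"
| "subarc_cond (Orbifold p' R') (Long p q L R) \<longleftrightarrow>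
     p' \<le> min p q \<and>
     left_points (Orbifold p' R') = L \<inter> {0<..<p'} \<and>
     right_points (Orbifold p' R') = R \<inter> {0<..<p'}"
| "subarc_cond (Long p' q' L' R') (Long p q L R) \<longleftrightarrow>
     p' \<le> p \<and> q' \<le> q \<and> L' = L \<inter> {0<..<p'} \<and> R' = R \<inter> {0<..<q'} \<and> p' \<notin> R' \<and> q' \<notin> L'"

definition subarc :: "nat \<Rightarrow> typeB_arc \<Rightarrow> typeB_arc \<Rightarrow> bool" where
  "subarc n \<alpha>' \<alpha> \<longleftrightarrow> is_typeB_arc n \<alpha>' \<and> is_typeB_arc n \<alpha> \<and> subarc_cond \<alpha>' \<alpha>"

end

(*
  The weak order is containment of inversion sets, and every biclosed symmetric set of pairs is an
  inversion set. The inversions of the join-irreducible j of an arc can be written down, and j <= x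
  becomes a condition "above" on the relative order in x of the endpoints and the points beside the
  arc. Reversing the roles of left and right gives the condition "below" of lying under the
  corresponding meet-irreducible m.

  Subarcs force: if j_1 is not below m_2 but all smaller elements are, then joining with m_2
  transports a contraction of j_1 to the arc of m_2. This, or its dual under x |-> -x, applies when
  one endpoint of an arc is moved at a time along a suitable chain of subarcs.

  Conversely, for a fixed arc, identify x and y when they are above the same subarcs of it. This is
  visibly compatible with meets. It is compatible with joins because the subarcs above which x lies
  determine those below which x lies and vice versa: if x is not below a subarc, a closest pair
  violating that condition spans a subarc with x above it. The congruence so obtained contracts
  exactly the join-irreducibles whose arcs are not subarcs of the given one.
*)

theory Submission
  imports Defs
begin

subsection \<open>The weak order through inversion sets\<close>

text \<open>The main difficulty is the central symmetry. An inversion \<open>(a, b)\<close> brings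
  \<open>(- b, - a)\<close> with it, and transitivity adds pairs between the two halves. The pairs
  that an arc itself demands cause no trouble when an endpoint is moved; the added ones can keep
  smaller elements from lying below the wanted meet-irreducible, namely when the negative of a moved
  endpoint lies beside the arc or at its other end. Hence the side conditions of the forcing rules
  and the detours in the chains.

  The second difficulty is the origin. It is carried along as the value 0 at position 0, so a sign
  change is an adjacent swap governed by \<open>0 < x 1\<close>, and inversion sets contain pairs
  with 0. But 0 is never an endpoint of an arc, so a closest violating pair that involves 0 has to
  be widened to one with nonzero endpoints.

  A long arc is encoded by its representative right of the origin: the right piece is the positive
  part, the left piece the negated negative part. One set \<open>R\<close> over an interval of
  integers then covers all kinds of arcs, and passing to a subarc means restricting \<open>R\<close>
  to a subinterval.\<close>

lemma signed_perms_apply_inv [simp]: "x \<in> signed_perms n \<Longrightarrow> x (inv x a) = a"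
  by (auto simp: signed_perms_def intro: permutes_inverses)

lemma signed_perms_inv_apply [simp]: "x \<in> signed_perms n \<Longrightarrow> inv x (x a) = a"
  by (auto simp: signed_perms_def intro: permutes_inverses)

lemma signed_perms_uminus: "x \<in> signed_perms n \<Longrightarrow> x (- a) = - x a"
  by (auto simp: signed_perms_def)

lemma signed_perms_inv_uminus: "x \<in> signed_perms n \<Longrightarrow> inv x (- a) = - inv x a"
  using signed_perms_inv_apply[of x n "- inv x a"] by (simp add: signed_perms_uminus)

lemma signed_perms_zero [simp]: "x \<in> signed_perms n \<Longrightarrow> x 0 = 0"
  using signed_perms_uminus[of x n 0] by simp

lemma signed_perms_inv_zero [simp]: "x \<in> signed_perms n \<Longrightarrow> inv x 0 = 0"
  using signed_perms_inv_uminus[of x n 0] by simp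

lemma signed_perms_eq_iff: "x \<in> signed_perms n \<Longrightarrow> x a = x b \<longleftrightarrow> a = b"
  by (metis signed_perms_inv_apply)

lemma signed_perms_inv_eq_iff: "x \<in> signed_perms n \<Longrightarrow> inv x a = inv x b \<longleftrightarrow> a = b"
  by (metis signed_perms_apply_inv)

lemma signed_perms_inv_eq_zero_iff: "x \<in> signed_perms n \<Longrightarrow> inv x a = 0 \<longleftrightarrow> a = 0"
  by (metis signed_perms_inv_zero signed_perms_inv_eq_iff)

lemma signed_perms_inv_mem: "x \<in> signed_perms n \<Longrightarrow> inv x \<in> signed_perms n"
  using signed_perms_inv_uminus[of x n] by (auto simp: signed_perms_def intro: permutes_inv)

lemma signed_perms_outside: "x \<in> signed_perms n \<Longrightarrow> int n < \<bar>a\<bar> \<Longrightarrow> x a = a"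
  unfolding signed_perms_def by (elim CollectE conjE permutes_not_in) auto

lemma signed_perms_inside:
  assumes "x \<in> signed_perms n" "\<bar>a\<bar> \<le> int n" shows "\<bar>x a\<bar> \<le> int n"
proof (cases "a = 0")
  case True then show ?thesis using assms by simp
next
  case False
  have "x permutes ({- int n..int n} - {0})" using assms by (simp add: signed_perms_def)
  then have "x a \<in> {- int n..int n} - {0}" using False assms(2)
    by (subst permutes_in_image) (auto simp: abs_le_iff)
  then show ?thesis by auto
qed

lemmas signed_perms_inv_outside = signed_perms_outside[OF signed_perms_inv_mem]
lemmas signed_perms_inv_inside = signed_perms_inside[OF signed_perms_inv_mem]

definition inversions :: "(int \<Rightarrow> int) \<Rightarrow> (int \<times> int) set" where
  "inversions x = {(a, b). a < b \<and> inv x b < inv x a}"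

lemma mem_inversions: "(a, b) \<in> inversions x \<longleftrightarrow> a < b \<and> inv x b < inv x a"
  by (simp add: inversions_def)

lemma inversions_uminus:
  "x \<in> signed_perms n \<Longrightarrow> (- b, - a) \<in> inversions x \<longleftrightarrow> (a, b) \<in> inversions x"
  by (auto simp: mem_inversions signed_perms_inv_uminus)

lemma inversions_bound:
  assumes x: "x \<in> signed_perms n" and ab: "(a, b) \<in> inversions x"
  shows "- int n \<le> a" "b \<le> int n"
proof -
  have *: "a < b" "inv x b < inv x a" using ab by (auto simp: mem_inversions)
  note o = signed_perms_inv_outside[OF x] and i = signed_perms_inv_inside[OF x]
  show "- int n \<le> a" "b \<le> int n"
    using * o[of a] o[of b] i[of a] i[of b] by linarith+
qed

lemma inversions_trans: "(a, b) \<in> inversions x \<Longrightarrow> (b, c) \<in> inversions x \<Longrightarrow> (a, c) \<in> inversions x"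
  by (auto simp: mem_inversions)

lemma inversions_cotrans:
  "(a, c) \<in> inversions x \<Longrightarrow> a < b \<Longrightarrow> b < c \<Longrightarrow> (a, b) \<in> inversions x \<or> (b, c) \<in> inversions x"
  by (auto simp: mem_inversions)

lemma finite_inversions:
  assumes "x \<in> signed_perms n" shows "finite (inversions x)"
proof (rule finite_subset)
  show "inversions x \<subseteq> {- int n..int n} \<times> {- int n..int n}"
    using inversions_bound[OF assms] by (force simp: inversions_def)
qed simp

text \<open>The map \<open>inv y \<circ> x\<close> is strictly increasing on 0..n, starts at 0 and
  cannot exceed n, so it is the identity there; oddness covers the negative positions. The
  comparison at \<open>i = 0\<close> is the one that fixes the sign of the first entry.\<close>

lemma signed_perms_eqI:
  assumes x: "x \<in> signed_perms n" and y: "y \<in> signed_perms n"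
    and mono: "\<And>i. 0 \<le> i \<Longrightarrow> i < int n \<Longrightarrow> inv y (x i) < inv y (x (i + 1))"
  shows "x = y"
proof -
  define f where "f = inv y \<circ> x"
  have step: "f i < f (i + 1)" if "0 \<le> i" "i < int n" for i using mono that by (simp add: f_def)
  have lower: "int k \<le> f (int k)" if "k \<le> n" for k using that
  proof (induction k)
    case 0 then show ?case using x y by (simp add: f_def)
  next
    case (Suc k) then show ?case using step[of "int k"] by (simp add: add.commute)
  qed
  have upper: "f (int n - int k) \<le> int n - int k" if "k \<le> n" for k using that
  proof (induction k)
    case 0
    have "\<bar>f (int n)\<bar> \<le> int n"
      unfolding f_def comp_def
      using signed_perms_inside[OF x] signed_perms_inv_inside[OF y] by simp
    then show ?case by simp
  next
    case (Suc k)
    then have "f (int n - int (Suc k)) < f (int n - int k)"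
      using step[of "int n - int (Suc k)"] by (simp add: algebra_simps)
    then show ?case using Suc by simp
  qed
  have eq: "x i = y i" if "0 \<le> i" "i \<le> int n" for i
  proof -
    have "f i = i" using lower[of "nat i"] upper[of "n - nat i"] that by (simp add: of_nat_diff)
    then show ?thesis using y by (metis comp_apply f_def signed_perms_apply_inv)
  qed
  show ?thesis
  proof
    fix i
    consider "0 \<le> i \<and> i \<le> int n" | "0 \<le> - i \<and> - i \<le> int n" | "int n < \<bar>i\<bar>" by linarith
    then show "x i = y i"
    proof cases
      case 2
      then have "x (- i) = y (- i)" using eq by blast
      then show ?thesis using x y by (simp add: signed_perms_uminus)
    qed (use eq x y in \<open>auto simp: signed_perms_outside\<close>)
  qed
qed

lemma inversions_inject:
  assumes x: "x \<in> signed_perms n" and y: "y \<in> signed_perms n" and "inversions x = inversions y"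
  shows "x = y"
proof -
  have "inv y a < inv y b" if "inv x a < inv x b" for a b
  proof -
    have "a \<noteq> b" using that by auto
    then consider "a < b" | "b < a" by linarith
    then show ?thesis
    proof cases
      case 1
      then have "(a, b) \<notin> inversions y" unfolding assms(3)[symmetric] using that by (simp add: mem_inversions)
      moreover have "inv y a \<noteq> inv y b" using 1 signed_perms_inv_eq_iff[OF y, of a b] by simp
      ultimately show ?thesis using 1 by (simp add: mem_inversions)
    next
      case 2
      then show ?thesis using that assms(3) by (metis mem_inversions)
    qed
  qed
  then show ?thesis using x y by (intro signed_perms_eqI) auto
qed

section \<open>Simple reflections and their effect on inversions\<close>

definition adj_swap :: "int \<Rightarrow> int \<Rightarrow> int" where
  "adj_swap i = (if i = 0 then transpose (- 1) 1 else transpose i (i + 1) \<circ> transpose (- i - 1) (- i))"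

lemma adj_swap_apply:
  assumes "0 \<le> i"
  shows "adj_swap i k = (if i = 0 then (if k = 1 then - 1 else if k = - 1 then 1 else k)
    else if k = i then i + 1 else if k = i + 1 then i
    else if k = - i then - i - 1 else if k = - i - 1 then - i else k)"
  using assms by (auto simp: adj_swap_def transpose_def)

lemma adj_swap_involutive: "0 \<le> i \<Longrightarrow> adj_swap i (adj_swap i k) = k"
  by (auto simp: adj_swap_apply)

lemma adj_swap_mem:
  assumes "0 \<le> i" "i < int n" shows "adj_swap i \<in> signed_perms n"
proof -
  have "adj_swap i permutes ({- int n..int n} - {0})"
    using assms unfolding adj_swap_def
    by (auto intro!: permutes_swap_id permutes_compose)
  then show ?thesis using assms by (auto simp: signed_perms_def adj_swap_apply)
qed

lemma signed_perms_comp: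
  "x \<in> signed_perms n \<Longrightarrow> y \<in> signed_perms n \<Longrightarrow> x \<circ> y \<in> signed_perms n"
  by (auto simp: signed_perms_def intro: permutes_compose)

text \<open>Since \<open>x\<close> is odd with \<open>x 0 = 0\<close>, the condition
  \<open>x (- 1) < x 1\<close> says \<open>x 0 < x 1\<close>. The sign change thus becomes the case
  \<open>i = 0\<close> of an ascent, and both kinds of cover can be treated together.\<close>

lemma weak_covered_iff:
  "weak_covered n x z \<longleftrightarrow> x \<in> signed_perms n \<and>
     (\<exists>i. 0 \<le> i \<and> i < int n \<and> x i < x (i + 1) \<and> z = x \<circ> adj_swap i)"
proof
  assume "weak_covered n x z"
  then have x: "x \<in> signed_perms n" and
    c: "(1 \<le> n \<and> x (- 1) < x 1 \<and> z = x \<circ> transpose (- 1) 1) \<or>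
      (\<exists>i. 1 \<le> i \<and> i \<le> int n - 1 \<and> x i < x (i + 1) \<and>
           z = x \<circ> transpose i (i + 1) \<circ> transpose (- i - 1) (- i))"
    by (auto simp: weak_covered_def)
  from c have "\<exists>i. 0 \<le> i \<and> i < int n \<and> x i < x (i + 1) \<and> z = x \<circ> adj_swap i"
  proof (elim disjE exE conjE)
    assume "1 \<le> n" "x (- 1) < x 1" "z = x \<circ> transpose (- 1) 1"
    then show ?thesis
      using x signed_perms_uminus[OF x, of 1] by (intro exI[of _ 0]) (auto simp: adj_swap_def)
  next
    fix i assume "1 \<le> i" "i \<le> int n - 1" "x i < x (i + 1)"
      "z = x \<circ> transpose i (i + 1) \<circ> transpose (- i - 1) (- i)"
    then show ?thesis by (intro exI[of _ i]) (auto simp: adj_swap_def comp_assoc)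
  qed
  then show "x \<in> signed_perms n \<and>
     (\<exists>i. 0 \<le> i \<and> i < int n \<and> x i < x (i + 1) \<and> z = x \<circ> adj_swap i)" using x by blast
next
  assume "x \<in> signed_perms n \<and>
     (\<exists>i. 0 \<le> i \<and> i < int n \<and> x i < x (i + 1) \<and> z = x \<circ> adj_swap i)"
  then obtain i where x: "x \<in> signed_perms n" and i: "0 \<le> i" "i < int n" "x i < x (i + 1)"
    and z: "z = x \<circ> adj_swap i" by blast
  have "z \<in> signed_perms n" unfolding z using x i by (intro signed_perms_comp adj_swap_mem)
  then show "weak_covered n x z"
    using x i z signed_perms_uminus[OF x, of 1]
    by (cases "i = 0") (auto simp: weak_covered_def adj_swap_def comp_assoc intro!: exI[of _ i])
qed

lemma inv_comp_adj_swap: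
  assumes "x \<in> signed_perms n" "0 \<le> i" "i < int n"
  shows "inv (x \<circ> adj_swap i) a = adj_swap i (inv x a)"
proof -
  have "x \<circ> adj_swap i \<in> signed_perms n" using assms by (intro signed_perms_comp adj_swap_mem)
  moreover have "(x \<circ> adj_swap i) (adj_swap i (inv x a)) = a"
    using assms by (simp add: adj_swap_involutive)
  ultimately show ?thesis by (metis signed_perms_inv_apply)
qed

text \<open>Because 0 counts as a value, the central swap adds three pairs: the entries at -1 and 1
  are inverted with each other and each of them with 0.\<close>

definition swap_pairs :: "(int \<Rightarrow> int) \<Rightarrow> int \<Rightarrow> (int \<times> int) set" where
  "swap_pairs x i = {(x i, x (i + 1)), (- x (i + 1), - x i)} \<union>
     (if i = 0 then {(- x 1, x 1)} else {})"

lemma adj_swap_less_iff: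
  assumes "0 \<le> i" "k \<noteq> l"
  shows "adj_swap i k < adj_swap i l \<longleftrightarrow>
    (if {k, l} \<subseteq> {i, i + 1} \<or> {k, l} \<subseteq> {- i - 1, - i} \<or> i = 0 \<and> {k, l} \<subseteq> {- 1, 1}
     then l < k else k < l)"
  using assms by (auto simp: adj_swap_apply)

lemma inversions_comp_adj_swap:
  assumes x: "x \<in> signed_perms n" and i: "0 \<le> i" "i < int n" "x i < x (i + 1)"
  shows "inversions (x \<circ> adj_swap i) = inversions x \<union> swap_pairs x i"
proof -
  have "(a, b) \<in> inversions (x \<circ> adj_swap i) \<longleftrightarrow> (a, b) \<in> inversions x \<union> swap_pairs x i" for a b
  proof (cases "a < b")
    case False
    then show ?thesis
      using i x by (auto simp: mem_inversions swap_pairs_def)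
  next
    case True
    define k l where "k = inv x a" and "l = inv x b"
    have ab: "a = x k" "b = x l" using x by (auto simp: k_def l_def)
    have kl: "l \<noteq> k" using True x by (auto simp: k_def l_def signed_perms_inv_eq_iff)
    have eq: "x s = x t \<longleftrightarrow> s = t" for s t using x by (rule signed_perms_eq_iff)
    have neg: "- x s = x (- s)" for s using x by (simp add: signed_perms_uminus)
    have "- i - 1 = - (i + 1)" by simp
    then have "x (- i - 1) = - x (i + 1)" using neg by metis
    then have lt: "x i < x (i + 1)" "x (- i - 1) < x (- i)" using i neg[of i] by simp_all
    have "(a, b) \<in> inversions (x \<circ> adj_swap i) \<longleftrightarrow> adj_swap i l < adj_swap i k"
      using True x i by (simp add: mem_inversions inv_comp_adj_swap k_def l_def)
    moreover have "(a, b) \<in> inversions x \<longleftrightarrow> l < k" using True by (simp add: mem_inversions k_def l_def)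
    moreover have "(a, b) \<in> swap_pairs x i \<longleftrightarrow> k = i \<and> l = i + 1 \<or> k = - i - 1 \<and> l = - i \<or> i = 0 \<and> k = -1 \<and> l = 1"
      by (auto simp: swap_pairs_def ab neg eq algebra_simps)
    moreover have "adj_swap i l < adj_swap i k \<longleftrightarrow> l < k \<or> (k = i \<and> l = i + 1 \<or> k = - i - 1 \<and> l = - i \<or> i = 0 \<and> k = -1 \<and> l = 1)"
    proof -
      have z: "i = 0 \<Longrightarrow> x 0 < x 1 \<and> x (-1) < x 0 \<and> x (- 1) < x 1" using lt by auto
      have "\<not> (k = i + 1 \<and> l = i)" "\<not> (k = - i \<and> l = - i - 1)" "i = 0 \<Longrightarrow> \<not> (k = 1 \<and> l = - 1)"
        using True lt z by (auto simp: ab)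
      then show ?thesis using kl i(1) by (subst adj_swap_less_iff) auto
    qed
    ultimately show ?thesis by auto
  qed
  then show ?thesis by auto
qed

lemma weak_covered_mem: "weak_covered n x y \<Longrightarrow> x \<in> signed_perms n \<and> y \<in> signed_perms n"
  by (simp add: weak_covered_def)

lemma weak_covered_inversions:
  assumes "weak_covered n x y" shows "inversions x \<subset> inversions y"
proof -
  obtain i where i: "x \<in> signed_perms n" "0 \<le> i" "i < int n" "x i < x (i + 1)" "y = x \<circ> adj_swap i"
    using assms by (auto simp: weak_covered_iff)
  have "(x i, x (i + 1)) \<notin> inversions x" using i by (simp add: mem_inversions)
  moreover have "(x i, x (i + 1)) \<in> swap_pairs x i" by (simp add: swap_pairs_def)
  moreover have "inversions y = inversions x \<union> swap_pairs x i" using i inversions_comp_adj_swap by blast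
  ultimately show ?thesis by blast
qed

text \<open>As \<open>x\<close> and \<open>y\<close> differ, some neighbouring entries of
  \<open>x\<close> stand in \<open>y\<close> in the opposite order. Containment of the inversion
  sets makes them an ascent of \<open>x\<close>, and swapping them adds only inversions of
  \<open>y\<close>.\<close>

lemma exists_cover_below:
  assumes x: "x \<in> signed_perms n" and y: "y \<in> signed_perms n"
    and le: "inversions x \<subseteq> inversions y" and "x \<noteq> y"
  obtains z where "weak_covered n x z" "inversions z \<subseteq> inversions y"
proof -
  obtain i where i: "0 \<le> i" "i < int n" "\<not> inv y (x i) < inv y (x (i + 1))"
    using signed_perms_eqI[OF x y] \<open>x \<noteq> y\<close> by blast
  have ne: "x i \<noteq> x (i + 1)" using x by (simp add: signed_perms_eq_iff)
  have lt: "x i < x (i + 1)"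
  proof (rule ccontr)
    assume "\<not> x i < x (i + 1)"
    then have "(x (i + 1), x i) \<in> inversions x" using ne x by (auto simp: mem_inversions)
    then have "(x (i + 1), x i) \<in> inversions y" using le by blast
    then show False using i(3) by (simp add: mem_inversions)
  qed
  have p: "(x i, x (i + 1)) \<in> inversions y"
    using lt i(3) ne signed_perms_inv_eq_iff[OF y, of "x i" "x (i + 1)"] by (simp add: mem_inversions)
  then have m: "(- x (i + 1), - x i) \<in> inversions y" using y by (simp add: inversions_uminus)
  \<comment> \<open>At the centre the third pair follows from the other two by transitivity through
    0.\<close>
  have "i = 0 \<Longrightarrow> (- x 1, x 1) \<in> inversions y"
    using p m x inversions_trans[of "- x 1" 0 y "x 1"] by simp
  then have "inversions (x \<circ> adj_swap i) \<subseteq> inversions y"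
    using p m le inversions_comp_adj_swap[OF x i(1,2) lt] by (auto simp: swap_pairs_def)
  moreover have "weak_covered n x (x \<circ> adj_swap i)" using x i lt by (auto simp: weak_covered_iff)
  ultimately show ?thesis using that by blast
qed

lemma weak_le_iff:
  assumes x: "x \<in> signed_perms n" and y: "y \<in> signed_perms n"
  shows "(weak_covered n)\<^sup>*\<^sup>* x y \<longleftrightarrow> inversions x \<subseteq> inversions y"
proof
  assume "(weak_covered n)\<^sup>*\<^sup>* x y"
  then show "inversions x \<subseteq> inversions y"
    by (induction rule: rtranclp_induct) (use weak_covered_inversions in blast)+
next
  assume "inversions x \<subseteq> inversions y"
  with x show "(weak_covered n)\<^sup>*\<^sup>* x y"
  proof (induction "card (inversions y - inversions x)" arbitrary: x rule: less_induct)
    case less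
    show ?case
    proof (cases "x = y")
      case False
      obtain z where z: "weak_covered n x z" "inversions z \<subseteq> inversions y"
        using exists_cover_below[OF less.prems(1) y less.prems(2) False] by blast
      have "inversions y - inversions z \<subset> inversions y - inversions x"
        using weak_covered_inversions[OF z(1)] z(2) by blast
      then have "card (inversions y - inversions z) < card (inversions y - inversions x)"
        using finite_inversions[OF y] by (intro psubset_card_mono) auto
      then have "(weak_covered n)\<^sup>*\<^sup>* z y" using less.hyps z weak_covered_mem by blast
      then show ?thesis using z(1) by (auto intro: converse_rtranclp_into_rtranclp)
    qed simp
  qed
qed

subsection \<open>Lattice operations\<close>

text \<open>The biclosed condition: the last clause says that the pairs \<open>a < b\<close> outside
  \<open>I\<close> compose as well.\<close>

definition inversion_set :: "nat \<Rightarrow> (int \<times> int) set \<Rightarrow> bool" where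
  "inversion_set n I \<longleftrightarrow>
     (\<forall>a b. (a, b) \<in> I \<longrightarrow> a < b \<and> - int n \<le> a \<and> b \<le> int n \<and> (- b, - a) \<in> I) \<and> trans I \<and>
     (\<forall>a b c. (a, c) \<in> I \<longrightarrow> a < b \<longrightarrow> b < c \<longrightarrow> (a, b) \<in> I \<or> (b, c) \<in> I)"

lemma inversion_set_inversions:
  assumes "x \<in> signed_perms n" shows "inversion_set n (inversions x)"
  unfolding inversion_set_def trans_def
proof (intro conjI allI impI)
  fix a b assume ab: "(a, b) \<in> inversions x"
  then show "a < b" by (simp add: mem_inversions)
  show "- int n \<le> a" "b \<le> int n" using inversions_bound[OF assms ab] .
  show "(- b, - a) \<in> inversions x" using ab assms by (simp add: inversions_uminus)
qed (use inversions_trans inversions_cotrans in blast)+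

text \<open>Reversing the natural order on exactly the pairs in \<open>I\<close> gives a linear
  order, since \<open>I\<close> and its complement are both transitive. Counting predecessors turns
  this order into positions, and the symmetry of \<open>I\<close> makes the positions odd.\<close>

lemma inversion_set_realized:
  assumes I: "inversion_set n I"
  obtains x where "x \<in> signed_perms n" "inversions x = I"
proof -
  define S where "S = {- int n..int n}"
  define lt where "lt a b \<longleftrightarrow> (a < b \<and> (a, b) \<notin> I) \<or> (b < a \<and> (b, a) \<in> I)" for a b
  \<comment> \<open>There are 2n + 1 values including 0; subtracting n makes the ranks run from -n
    to n with 0 in the middle.\<close>
  define rank where "rank a = int (card {c \<in> S. lt c a}) - int n" for a
  define pos where "pos a = (if a \<in> S then rank a else a)" for a
  have Ib: "a < b" "- int n \<le> a" "b \<le> int n" "(- b, - a) \<in> I" if "(a, b) \<in> I" for a b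
    using I that by (auto simp: inversion_set_def)
  have Iu: "(- b, - a) \<in> I \<longleftrightarrow> (a, b) \<in> I" for a b using Ib(4)[of a b] Ib(4)[of "- b" "- a"] by auto
  have It: "(a, b) \<in> I \<Longrightarrow> (b, c) \<in> I \<Longrightarrow> (a, c) \<in> I" for a b c
    using I by (auto simp: inversion_set_def dest: transD)
  have Ic: "(a, c) \<in> I \<Longrightarrow> a < b \<Longrightarrow> b < c \<Longrightarrow> (a, b) \<in> I \<or> (b, c) \<in> I" for a b c
    using I unfolding inversion_set_def by blast
  have finS: "finite S" by (simp add: S_def)
  have lt_irrefl: "\<not> lt a a" for a by (simp add: lt_def)
  have lt_total: "a \<noteq> b \<Longrightarrow> lt a b \<longleftrightarrow> \<not> lt b a" for a b by (auto simp: lt_def)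
  have lt_trans: "lt a c" if "lt a b" "lt b c" for a b c
  proof -
    have "a \<noteq> c" using that lt_total[of a b] lt_irrefl by blast
    then consider "a < c" | "c < a" by linarith
    then show ?thesis
      using that It[of a b c] Ic[of a c b] It[of c b a] Ic[of c a b] It[of a c b] It[of b a c]
        It[of c a b] It[of b c a] Ic[of a b c] Ic[of b c a] Ic[of c b a] Ic[of b a c]
      by (cases; auto simp: lt_def; linarith)
  qed
  have lt_uminus: "lt (- b) (- a) \<longleftrightarrow> lt a b" for a b by (auto simp: lt_def Iu)
  have rank_less: "rank a < rank b" if "lt a b" "a \<in> S" for a b
  proof -
    have "{c \<in> S. lt c a} \<subset> {c \<in> S. lt c b}" using that lt_trans lt_irrefl by blast
    then show ?thesis using finS by (simp add: rank_def psubset_card_mono)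
  qed
  have rank_uminus: "rank (- a) = - rank a" if "a \<in> S" for a
  proof -
    have "bij_betw uminus {c \<in> S. lt a c} {c \<in> S. lt c (- a)}"
      by (rule bij_betwI[where g = uminus]) (use lt_uminus in \<open>fastforce simp: S_def\<close>)+
    then have "card {c \<in> S. lt c (- a)} = card {c \<in> S. lt a c}" by (simp add: bij_betw_same_card)
    moreover have "card {c \<in> S. lt c a} + card {c \<in> S. lt a c} = card (S - {a})"
    proof -
      have "S - {a} = {c \<in> S. lt c a} \<union> {c \<in> S. lt a c}" using lt_total lt_irrefl by blast
      moreover have "{c \<in> S. lt c a} \<inter> {c \<in> S. lt a c} = {}" using lt_trans lt_irrefl by blast
      ultimately show ?thesis using finS by (simp add: card_Un_disjoint)
    qed
    moreover have "int (card (S - {a})) = 2 * int n" using that by (simp add: S_def)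
    ultimately show ?thesis by (simp add: rank_def)
  qed
  have rank_range: "rank a \<in> S" if "a \<in> S" for a
  proof -
    have up: "rank b \<le> int n" if "b \<in> S" for b
    proof -
      have "card {c \<in> S. lt c b} \<le> card (S - {b})" using finS lt_irrefl by (intro card_mono) auto
      moreover have "int (card (S - {b})) = 2 * int n" using that by (simp add: S_def)
      ultimately show ?thesis by (simp add: rank_def)
    qed
    show ?thesis using up[OF that] up[of "- a"] rank_uminus[OF that] that by (auto simp: S_def)
  qed
  have inj: "inj_on rank S"
    using rank_less lt_total by (intro inj_onI) (metis less_irrefl)
  have "pos permutes S"
    using inj rank_range finS by (intro inj_imp_permutes) (auto simp: pos_def inj_on_def)
  moreover have pos_uminus: "pos (- a) = - pos a" for a
    using rank_uminus[of a] by (auto simp: pos_def S_def)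
  moreover have "pos 0 = 0" using pos_uminus[of 0] by simp
  ultimately have pos: "pos \<in> signed_perms n"
    unfolding signed_perms_def by (auto intro: permutes_superset simp: S_def)
  \<comment> \<open>Inversions compare positions of values, so \<open>pos\<close> is the inverse of
    the permutation sought.\<close>
  define x where "x = inv pos"
  have x: "x \<in> signed_perms n" unfolding x_def using pos by (rule signed_perms_inv_mem)
  have inv_x: "inv x = pos" unfolding x_def
    using pos by (auto simp: signed_perms_def intro: permutes_inv_inv)
  have "(a, b) \<in> inversions x \<longleftrightarrow> (a, b) \<in> I" for a b
  proof (cases "a < b \<and> - int n \<le> a \<and> b \<le> int n")
    case True
    then have S: "a \<in> S" "b \<in> S" by (auto simp: S_def)
    then have "pos b < pos a \<longleftrightarrow> lt b a"
      using rank_less[of a b] rank_less[of b a] lt_total[of a b] True by (auto simp: pos_def)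
    then show ?thesis using True by (auto simp: mem_inversions inv_x lt_def)
  next
    case False
    then show ?thesis using inversions_bound[OF x] Ib by (auto simp: mem_inversions)
  qed
  then have "inversions x = I" by auto
  then show ?thesis using that x by blast
qed

text \<open>The point to check is cotransitivity. A value strictly between the ends of a chain of
  pairs is a joint of the chain or falls inside a link. The link belongs to \<open>I\<close> or
  \<open>J\<close> and can be split there, and the remaining links complete one of the two
  halves.\<close>

lemma inversion_set_trancl_Un:
  assumes I: "inversion_set n I" and J: "inversion_set n J"
  shows "inversion_set n ((I \<union> J)\<^sup>+)"
proof -
  have base: "a < b \<and> - int n \<le> a \<and> b \<le> int n \<and> (- b, - a) \<in> I \<union> J" if "(a, b) \<in> I \<union> J" for a b
    using that I J by (auto simp: inversion_set_def)
  have cot: "(a, b) \<in> I \<union> J \<or> (b, c) \<in> I \<union> J"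
    if "(a, c) \<in> I \<union> J" "a < b" "b < c" for a b c
  proof -
    have "(a, c) \<in> K \<Longrightarrow> inversion_set n K \<Longrightarrow> (a, b) \<in> K \<or> (b, c) \<in> K" for K
      using that unfolding inversion_set_def by blast
    then show ?thesis using that(1) I J by blast
  qed
  have "a < b \<and> - int n \<le> a \<and> b \<le> int n \<and> (- b, - a) \<in> (I \<union> J)\<^sup>+" if "(a, b) \<in> (I \<union> J)\<^sup>+" for a b
    using that
  proof (induction rule: trancl_induct)
    case (base b) then show ?case using \<open>\<And>a b. (a, b) \<in> I \<union> J \<Longrightarrow> _\<close> by blast
  next
    case (step b c) then show ?case using base[of b c] by (auto intro: trancl_into_trancl2)
  qed
  moreover have "(a, b) \<in> (I \<union> J)\<^sup>+ \<or> (b, c) \<in> (I \<union> J)\<^sup>+"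
    if "(a, c) \<in> (I \<union> J)\<^sup>+" "a < b" "b < c" for a b c
    using that
  proof (induction arbitrary: b rule: trancl_induct)
    case (base c)
    then have "(a, b) \<in> I \<union> J \<or> (b, c) \<in> I \<union> J" using cot by blast
    then show ?case by blast
  next
    case (step d c)
    consider "b < d" | "b = d" | "d < b" by linarith
    then show ?case
    proof cases
      case 1 then show ?thesis using step by (meson trancl.trancl_into_trancl)
    next
      case 2 then show ?thesis using step by blast
    next
      case 3
      then have "(d, b) \<in> I \<union> J \<or> (b, c) \<in> I \<union> J" using step(2,5) cot by blast
      then show ?thesis using step(1) by (meson r_into_trancl' trancl.trancl_into_trancl)
    qed
  qed
  ultimately show ?thesis unfolding inversion_set_def by (blast intro: trans_trancl)
qed

text \<open>The choice is unambiguous, since a signed permutation is determined by its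
  inversions.\<close>

definition weak_sup :: "nat \<Rightarrow> (int \<Rightarrow> int) \<Rightarrow> (int \<Rightarrow> int) \<Rightarrow> (int \<Rightarrow> int)" where
  "weak_sup n x y = (SOME z. z \<in> signed_perms n \<and> inversions z = (inversions x \<union> inversions y)\<^sup>+)"

lemma
  assumes "x \<in> signed_perms n" "y \<in> signed_perms n"
  shows weak_sup_mem: "weak_sup n x y \<in> signed_perms n"
    and inversions_weak_sup: "inversions (weak_sup n x y) = (inversions x \<union> inversions y)\<^sup>+"
proof -
  have "\<exists>z. z \<in> signed_perms n \<and> inversions z = (inversions x \<union> inversions y)\<^sup>+"
    using assms inversion_set_realized[OF inversion_set_trancl_Un] inversion_set_inversions by metis
  from someI_ex[OF this, folded weak_sup_def]
  show "weak_sup n x y \<in> signed_perms n"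
    "inversions (weak_sup n x y) = (inversions x \<union> inversions y)\<^sup>+" by blast+
qed

definition weak_le :: "(int \<Rightarrow> int) \<Rightarrow> (int \<Rightarrow> int) \<Rightarrow> bool" where
  "weak_le x y \<longleftrightarrow> inversions x \<subseteq> inversions y"

lemma weak_le_refl [simp]: "weak_le x x"
  by (simp add: weak_le_def)

lemma weak_le_trans: "weak_le x y \<Longrightarrow> weak_le y z \<Longrightarrow> weak_le x z"
  by (auto simp: weak_le_def)

lemma weak_le_antisym:
  "x \<in> signed_perms n \<Longrightarrow> y \<in> signed_perms n \<Longrightarrow> weak_le x y \<Longrightarrow> weak_le y x \<Longrightarrow> x = y"
  by (auto simp: weak_le_def intro: inversions_inject)

lemma weak_leD: "weak_le x y \<Longrightarrow> (a, b) \<in> inversions x \<Longrightarrow> (a, b) \<in> inversions y"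
  by (auto simp: weak_le_def)

lemma weak_sup_le_iff:
  assumes "x \<in> signed_perms n" "y \<in> signed_perms n" "z \<in> signed_perms n"
  shows "weak_le (weak_sup n x y) z \<longleftrightarrow> weak_le x z \<and> weak_le y z"
proof -
  have "trans (inversions z)" by (rule transI, rule inversions_trans)
  then have "(inversions x \<union> inversions y)\<^sup>+ \<subseteq> inversions z" if "inversions x \<union> inversions y \<subseteq> inversions z"
    using that trancl_mono_subset[OF that] by (simp add: trancl_id)
  moreover have "inversions x \<union> inversions y \<subseteq> (inversions x \<union> inversions y)\<^sup>+" by auto
  ultimately show ?thesis using assms by (auto simp: inversions_weak_sup weak_le_def)
qed

section \<open>The order-reversing involution of the weak order\<close>

definition reversal :: "nat \<Rightarrow> int \<Rightarrow> int" where
  "reversal n i = (if \<bar>i\<bar> \<le> int n then - i else i)"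

text \<open>Negation of all entries, written as composition with the longest element so that points
  outside \<open>{- n..n}\<close> stay fixed.\<close>

definition negate :: "nat \<Rightarrow> (int \<Rightarrow> int) \<Rightarrow> (int \<Rightarrow> int)" where
  "negate n x = x \<circ> reversal n"

lemma reversal_mem: "reversal n \<in> signed_perms n"
proof -
  have "reversal n permutes ({- int n..int n} - {0})"
    by (rule inj_imp_permutes) (auto simp: reversal_def inj_on_def)
  then show ?thesis by (simp add: signed_perms_def reversal_def)
qed

lemma negate_mem [simp]: "x \<in> signed_perms n \<Longrightarrow> negate n x \<in> signed_perms n"
  unfolding negate_def by (intro signed_perms_comp reversal_mem)

lemma negate_negate [simp]: "negate n (negate n x) = x"
  by (auto simp: negate_def reversal_def)

lemma inv_negate:
  assumes "x \<in> signed_perms n" shows "inv (negate n x) a = reversal n (inv x a)"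
proof -
  have "negate n x (reversal n (inv x a)) = a"
    using assms by (simp add: negate_def) (simp add: reversal_def)
  then show ?thesis by (metis assms negate_mem signed_perms_inv_apply)
qed

lemma inversions_negate:
  assumes x: "x \<in> signed_perms n"
  shows "inversions (negate n x) = {(a, b). - int n \<le> a \<and> a < b \<and> b \<le> int n} - inversions x"
proof -
  have "(a, b) \<in> inversions (negate n x) \<longleftrightarrow>
    (a, b) \<in> {(a, b). - int n \<le> a \<and> a < b \<and> b \<le> int n} - inversions x" for a b
  proof (cases "- int n \<le> a \<and> a < b \<and> b \<le> int n")
    case True
    then have "\<bar>inv x a\<bar> \<le> int n" "\<bar>inv x b\<bar> \<le> int n" "inv x a \<noteq> inv x b"
      using signed_perms_inv_inside[OF x] signed_perms_inv_eq_iff[OF x, of a b] by auto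
    then show ?thesis using True x by (auto simp: mem_inversions inv_negate reversal_def)
  next
    case False
    then show ?thesis using inversions_bound[OF negate_mem[OF x]] by (auto simp: mem_inversions)
  qed
  then show ?thesis by auto
qed

lemma negate_le_iff:
  assumes "x \<in> signed_perms n" "y \<in> signed_perms n"
  shows "weak_le (negate n x) (negate n y) \<longleftrightarrow> weak_le y x"
proof -
  have "inversions y \<subseteq> {(a, b). - int n \<le> a \<and> a < b \<and> b \<le> int n}"
    using inversions_bound[OF assms(2)] by (auto simp: mem_inversions)
  then show ?thesis using assms unfolding weak_le_def by (simp add: inversions_negate) blast
qed

definition weak_inf :: "nat \<Rightarrow> (int \<Rightarrow> int) \<Rightarrow> (int \<Rightarrow> int) \<Rightarrow> (int \<Rightarrow> int)" where
  "weak_inf n x y = negate n (weak_sup n (negate n x) (negate n y))"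

lemma weak_inf_mem:
  "x \<in> signed_perms n \<Longrightarrow> y \<in> signed_perms n \<Longrightarrow> weak_inf n x y \<in> signed_perms n"
  by (simp add: weak_inf_def weak_sup_mem)

lemma le_weak_inf_iff:
  assumes x: "x \<in> signed_perms n" and y: "y \<in> signed_perms n" and z: "z \<in> signed_perms n"
  shows "weak_le z (weak_inf n x y) \<longleftrightarrow>
    weak_le z x \<and> weak_le z y"
proof -
  have "weak_le z (weak_inf n x y) \<longleftrightarrow>
    weak_le (weak_sup n (negate n x) (negate n y)) (negate n z)"
    using negate_le_iff[of "negate n z" n "weak_sup n (negate n x) (negate n y)"] assms
    by (simp add: weak_inf_def weak_sup_mem)
  then show ?thesis using assms by (simp add: weak_sup_le_iff negate_le_iff)
qed

lemma weak_inf_eqI: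
  assumes "x \<in> signed_perms n" "y \<in> signed_perms n" "z \<in> signed_perms n"
    and "\<And>w. w \<in> signed_perms n \<Longrightarrow> weak_le w z \<longleftrightarrow>
      weak_le w x \<and> weak_le w y"
  shows "weak_inf n x y = z"
  using assms weak_le_antisym[OF weak_inf_mem[OF assms(1,2)] assms(3)]
  by (metis le_weak_inf_iff weak_le_refl weak_inf_mem)

lemma weak_inf_negate:
  "weak_inf n (negate n x) (negate n y) = negate n (weak_sup n x y)"
  by (simp add: weak_inf_def)

lemma weak_sup_negate:
  "weak_sup n (negate n x) (negate n y) = negate n (weak_inf n x y)"
  by (simp add: weak_inf_def)

section \<open>Lattice congruences in terms of explicit joins and meets\<close>

lemma carrier_weak_order [simp]: "carrier (weak_order n) = signed_perms n"
  by (simp add: weak_order_def)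

lemma weak_order_le [simp]:
  "x \<in> signed_perms n \<Longrightarrow> y \<in> signed_perms n \<Longrightarrow>
    x \<sqsubseteq>\<^bsub>weak_order n\<^esub> y \<longleftrightarrow> weak_le x y"
  by (simp add: weak_order_def weak_le_iff weak_le_def)

lemma join_weak_order:
  assumes x: "x \<in> signed_perms n" and y: "y \<in> signed_perms n"
  shows "x \<squnion>\<^bsub>weak_order n\<^esub> y = weak_sup n x y"
proof -
  have U: "Upper (weak_order n) {x, y} =
      {w \<in> signed_perms n. weak_le (weak_sup n x y) w}"
    using x y by (auto simp: Upper_def weak_sup_le_iff)
  have "least (weak_order n) z (Upper (weak_order n) {x, y}) \<longleftrightarrow> z = weak_sup n x y" for z
    unfolding least_def U using weak_sup_mem[OF x y] weak_le_antisym[of z n "weak_sup n x y"] by auto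
  then show ?thesis by (simp add: join_def sup_def)
qed

lemma meet_weak_order:
  assumes x: "x \<in> signed_perms n" and y: "y \<in> signed_perms n"
  shows "x \<sqinter>\<^bsub>weak_order n\<^esub> y = weak_inf n x y"
proof -
  have L: "Lower (weak_order n) {x, y} =
      {w \<in> signed_perms n. weak_le w (weak_inf n x y)}"
    using x y by (auto simp: Lower_def le_weak_inf_iff)
  have "greatest (weak_order n) z (Lower (weak_order n) {x, y}) \<longleftrightarrow> z = weak_inf n x y" for z
    unfolding greatest_def L using weak_inf_mem[OF x y] weak_le_antisym[of z n "weak_inf n x y"] by auto
  then show ?thesis by (simp add: meet_def inf_def)
qed

lemma weak_congruence_iff:
  "lattice_congruence (weak_order n) \<theta> \<longleftrightarrow> equiv (signed_perms n) \<theta> \<and>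
     (\<forall>x x' y y'. (x, x') \<in> \<theta> \<longrightarrow> (y, y') \<in> \<theta> \<longrightarrow>
        (weak_sup n x y, weak_sup n x' y') \<in> \<theta> \<and> (weak_inf n x y, weak_inf n x' y') \<in> \<theta>)"
proof -
  have "x \<in> signed_perms n \<and> y \<in> signed_perms n" if "equiv (signed_perms n) \<theta>" "(x, y) \<in> \<theta>" for x y
    using that by (auto simp: equiv_def refl_on_def)
  then have "x \<squnion>\<^bsub>weak_order n\<^esub> y = weak_sup n x y \<and> x' \<squnion>\<^bsub>weak_order n\<^esub> y' = weak_sup n x' y' \<and>
      x \<sqinter>\<^bsub>weak_order n\<^esub> y = weak_inf n x y \<and> x' \<sqinter>\<^bsub>weak_order n\<^esub> y' = weak_inf n x' y'"
    if "equiv (signed_perms n) \<theta>" "(x, x') \<in> \<theta>" "(y, y') \<in> \<theta>" for x x' y y'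
    using that by (simp add: join_weak_order meet_weak_order)
  then show ?thesis unfolding lattice_congruence_def carrier_weak_order 
    by (intro conj_cong all_cong1 imp_cong refl) simp_all
qed

lemma weak_congruence_negate:
  assumes "lattice_congruence (weak_order n) \<theta>"
  shows "lattice_congruence (weak_order n) {(x, y). (negate n x, negate n y) \<in> \<theta>}"
proof -
  have e: "equiv (signed_perms n) \<theta>" and
    c: "(x, x') \<in> \<theta> \<Longrightarrow> (y, y') \<in> \<theta> \<Longrightarrow>
        (weak_sup n x y, weak_sup n x' y') \<in> \<theta> \<and> (weak_inf n x y, weak_inf n x' y') \<in> \<theta>" for x x' y y'
    using assms by (auto simp: weak_congruence_iff)
  have mem: "x \<in> signed_perms n" if "negate n x \<in> signed_perms n" for x
    using negate_mem[OF that] by simp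
  have "equiv (signed_perms n) {(x, y). (negate n x, negate n y) \<in> \<theta>}"
  proof (rule equivI)
    show "{(x, y). (negate n x, negate n y) \<in> \<theta>} \<subseteq> signed_perms n \<times> signed_perms n"
      using e mem by (auto simp: equiv_def)
    show "refl_on (signed_perms n) {(x, y). (negate n x, negate n y) \<in> \<theta>}"
      using e by (auto simp: equiv_def refl_on_def)
    show "sym {(x, y). (negate n x, negate n y) \<in> \<theta>}"
      using e by (auto simp: equiv_def sym_def)
    show "trans {(x, y). (negate n x, negate n y) \<in> \<theta>}"
      using e unfolding equiv_def trans_def by blast
  qed
  then show ?thesis using c by (auto simp: weak_congruence_iff weak_sup_negate[symmetric] weak_inf_negate[symmetric])
qed

lemma weak_inf_absorb:
  assumes "x \<in> signed_perms n" "y \<in> signed_perms n" "weak_le x y"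
  shows "weak_inf n x y = x"
  using assms weak_le_trans by (intro weak_inf_eqI) auto

lemma weak_inf_commute:
  assumes "x \<in> signed_perms n" "y \<in> signed_perms n"
  shows "weak_inf n x y = weak_inf n y x"
  using assms by (intro weak_inf_eqI) (auto simp: le_weak_inf_iff weak_inf_mem)

subsection \<open>Arcs in the symmetric model\<close>

text \<open>
  Lower endpoint \<open>p\<close>, upper endpoint \<open>q\<close>, right set \<open>R\<close>. If \<open>p < 0 < q\<close>, then of an arc and its
  mirror image only the one to the right of the origin is considered, and an arc through the origin
  is treated as if it passed to the right, so that \<open>0\<close> never belongs to \<open>R\<close>.
\<close>

definition signed_arc :: "nat \<Rightarrow> int \<Rightarrow> int \<Rightarrow> int set \<Rightarrow> bool" where
  "signed_arc n p q R \<longleftrightarrow> p < q \<and> p \<noteq> 0 \<and> q \<noteq> 0 \<and> - int n \<le> p \<and> q \<le> int n \<and>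
     R \<subseteq> {p<..<q} \<and> 0 \<notin> R \<and> - p \<notin> R \<and> - q \<notin> R \<and> (\<forall>c\<in>R. - c \<notin> R) \<and>
     (p = - q \<longrightarrow> (\<forall>c\<in>{0<..<q}. c \<in> R \<or> - c \<in> R))"

text \<open>
  \<open>above_arc\<close> characterizes the elements above the join-irreducible of the arc, \<open>below_arc\<close> those
  below the corresponding meet-irreducible.
\<close>

definition above_arc :: "int \<Rightarrow> int \<Rightarrow> int set \<Rightarrow> (int \<Rightarrow> int) \<Rightarrow> bool" where
  "above_arc p q R x \<longleftrightarrow>
     (\<forall>a\<in>insert p R. \<forall>b. b \<notin> R \<longrightarrow> a < b \<longrightarrow> b \<le> q \<longrightarrow> (a, b) \<in> inversions x)"

definition below_arc :: "int \<Rightarrow> int \<Rightarrow> int set \<Rightarrow> (int \<Rightarrow> int) \<Rightarrow> bool" where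
  "below_arc p q R x \<longleftrightarrow>
     (\<forall>b\<in>insert q R. \<forall>a. a \<notin> R \<longrightarrow> a < b \<longrightarrow> p \<le> a \<longrightarrow> (a, b) \<notin> inversions x)"

text \<open>
  The symmetric transitive closure of the pairs in \<open>above_arc\<close>: for \<open>0 < q\<close> the join-irreducible has
  \<open>insert p R\<close> at positive positions and its negative at negative ones, whence the third clause.
\<close>

definition arc_inversions :: "int \<Rightarrow> int \<Rightarrow> int set \<Rightarrow> (int \<times> int) set" where
  "arc_inversions p q R = {(a, b). a < b \<and>
     (a \<in> insert p R \<and> b \<notin> insert p R \<and> b \<le> q \<or>
      - b \<in> insert p R \<and> - a \<notin> insert p R \<and> - q \<le> a \<or>
      0 < q \<and> a \<in> insert p R \<and> - b \<in> insert p R)}"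

text \<open>Everything rests on \<open>A\<close> and \<open>- A\<close> being disjoint:
  \<open>signed_arc\<close> makes \<open>p\<close> nonzero and keeps 0, \<open>- p\<close> and
  opposite pairs out of \<open>R\<close>.\<close>

lemma inversion_set_arc_inversions:
  assumes "signed_arc n p q R" shows "inversion_set n (arc_inversions p q R)"
proof -
  define A where "A = insert p R"
  have A: "p \<le> c" "c < q" "- int n \<le> c" "- c \<notin> A" if "c \<in> A" for c
    using that assms by (auto simp: A_def signed_arc_def)
  have q: "q \<le> int n" "q \<noteq> 0" using assms by (auto simp: signed_arc_def)
  have I: "arc_inversions p q R = {(a, b). a < b \<and> (a \<in> A \<and> b \<notin> A \<and> b \<le> q \<or>
      - b \<in> A \<and> - a \<notin> A \<and> - q \<le> a \<or> 0 < q \<and> a \<in> A \<and> - b \<in> A)}"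
    by (simp add: arc_inversions_def A_def)
  show ?thesis unfolding inversion_set_def
  proof (intro conjI allI impI)
    fix a b assume ab: "(a, b) \<in> arc_inversions p q R"
    show "a < b" "(- b, - a) \<in> arc_inversions p q R" using ab by (auto simp: I)
    show "- int n \<le> a" "b \<le> int n" using ab A[of a] A[of "- b"] q by (auto simp: I)
  next
    show "trans (arc_inversions p q R)"
    proof (rule transI)
      fix a b c assume "(a, b) \<in> arc_inversions p q R" "(b, c) \<in> arc_inversions p q R"
      then show "(a, c) \<in> arc_inversions p q R"
        using A(4)[of a] A(4)[of b] A(4)[of "- b"] A(4)[of "- c"] q by (auto simp: I)
    qed
  next
    fix a b c assume "(a, c) \<in> arc_inversions p q R" "a < b" "b < c"
    then show "(a, b) \<in> arc_inversions p q R \<or> (b, c) \<in> arc_inversions p q R"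
      using A(4) by (auto simp: I; smt (verit))
  qed
qed

text \<open>The pairs demanded by \<open>above_arc\<close> are those of the first clause of
  \<open>arc_inversions\<close>. The second clause is their mirror image, and the third follows from
  the first two.\<close>

lemma above_arc_iff:
  assumes arc: "signed_arc n p q R" and x: "x \<in> signed_perms n"
  shows "above_arc p q R x \<longleftrightarrow> arc_inversions p q R \<subseteq> inversions x"
proof
  assume "arc_inversions p q R \<subseteq> inversions x"
  moreover have "(a, b) \<in> arc_inversions p q R"
    if "a \<in> insert p R" "b \<notin> R" "a < b" "b \<le> q" for a b
  proof -
    have "p \<le> a" using that arc by (auto simp: signed_arc_def)
    then show ?thesis using that by (auto simp: arc_inversions_def)
  qed
  ultimately show "above_arc p q R x" unfolding above_arc_def by blast
next
  assume above: "above_arc p q R x"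
  have R: "R \<subseteq> {p<..<q}" "- q \<notin> R" "q \<notin> R" "\<forall>c\<in>R. - c \<notin> R" "- p \<notin> R" "p < q" "p \<noteq> 0"
    using arc by (auto simp: signed_arc_def)
  define A where "A = insert p R"
  have S: "(a, b) \<in> inversions x" if "a \<in> A" "b \<notin> R" "a < b" "b \<le> q" for a b
    using above that unfolding above_arc_def A_def by blast
  have S': "(a, b) \<in> inversions x" if "- b \<in> A" "- a \<notin> R" "a < b" "- q \<le> a" for a b
    using S[of "- b" "- a"] that x by (simp add: inversions_uminus)
  have disj: "- c \<notin> A" if "c \<in> A" for c using R that by (auto simp: A_def)
  have "(a, b) \<in> inversions x" if "a \<in> A" "- b \<in> A" "a < b" "0 < q" for a b
  proof -
    have nR: "b \<notin> R" "- a \<notin> R" using that disj[of a] disj[of "- b"] by (auto simp: A_def)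
    consider "b \<le> q" | "- q \<le> a" | "a < - q" "q < b" by linarith
    then show ?thesis
    proof cases
      case 1 then show ?thesis using S nR that by blast
    next
      case 2 then show ?thesis using S' nR that by blast
    next
      \<comment> \<open>Neither \<open>q\<close> nor \<open>- q\<close> is in \<open>R\<close>, so
        \<open>- q\<close> can serve as the intermediate value between \<open>a\<close> and
        \<open>b\<close>.\<close>
      case 3
      have "(a, - q) \<in> inversions x" using S[of a "- q"] R 3 that by auto
      moreover have "(- q, b) \<in> inversions x" using S'[of b "- q"] R 3 that by auto
      ultimately show ?thesis by (rule inversions_trans)
    qed
  qed
  then show "arc_inversions p q R \<subseteq> inversions x"
    using S S' unfolding arc_inversions_def A_def[symmetric] by (auto simp: A_def)
qed

lemma join_irreducible_of_arc:
  assumes "signed_arc n p q R"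
  obtains j where "j \<in> signed_perms n" "inversions j = arc_inversions p q R"
    "\<And>x. x \<in> signed_perms n \<Longrightarrow> above_arc p q R x \<longleftrightarrow> weak_le j x"
  using inversion_set_realized[OF inversion_set_arc_inversions[OF assms]] above_arc_iff[OF assms]
  by (metis weak_le_def)

lemma signed_arc_uminus:
  assumes "signed_arc n p q R" shows "signed_arc n (- q) (- p) (uminus ` R)"
proof -
  have "c \<in> uminus ` R \<longleftrightarrow> - c \<in> R" for c by force
  then show ?thesis using assms by (force simp: signed_arc_def)
qed

text \<open>Negating the entries complements the inversion set and turns the picture upside down,
  with right points staying on the right. Statements about meet-irreducibles are obtained in this
  way from those about join-irreducibles.\<close>

lemma below_arc_iff_above_negate:
  assumes arc: "signed_arc n p q R" and x: "x \<in> signed_perms n"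
  shows "below_arc p q R x \<longleftrightarrow> above_arc (- q) (- p) (uminus ` R) (negate n x)"
proof -
  have m: "c \<in> uminus ` R \<longleftrightarrow> - c \<in> R" for c by force
  have "(\<forall>a\<in>insert (- q) (uminus ` R). \<forall>b. b \<notin> uminus ` R \<longrightarrow> a < b \<longrightarrow> b \<le> - p \<longrightarrow>
      (a, b) \<in> inversions (negate n x)) \<longleftrightarrow>
    (\<forall>a\<in>insert q R. \<forall>b. b \<notin> R \<longrightarrow> b < a \<longrightarrow> p \<le> b \<longrightarrow> (- a, - b) \<in> inversions (negate n x))"
    unfolding m by (force simp: minus_less_iff le_minus_iff)
  also have "\<dots> \<longleftrightarrow> (\<forall>a\<in>insert q R. \<forall>b. b \<notin> R \<longrightarrow> b < a \<longrightarrow> p \<le> b \<longrightarrow> (b, a) \<notin> inversions x)"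
  proof -
    have "(- a, - b) \<in> inversions (negate n x) \<longleftrightarrow> (b, a) \<notin> inversions x"
      if "a \<in> insert q R" "b < a" "p \<le> b" for a b
    proof -
      have "- int n \<le> b \<and> a \<le> int n" using that arc by (auto simp: signed_arc_def)
      then show ?thesis using that x inversions_uminus[OF negate_mem[OF x], of a b]
        by (auto simp: inversions_negate)
    qed
    then show ?thesis by (metis (lifting))
  qed
  finally show ?thesis by (simp add: below_arc_def above_arc_def)
qed

lemma above_arc_iff_below_negate:
  assumes arc: "signed_arc n p q R" and x: "x \<in> signed_perms n"
  shows "above_arc p q R x \<longleftrightarrow> below_arc (- q) (- p) (uminus ` R) (negate n x)"
  using below_arc_iff_above_negate[OF signed_arc_uminus[OF arc] negate_mem[OF x]]
  by (simp add: image_image)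

lemma above_arc_weak_inf:
  assumes "signed_arc n p q R" "x \<in> signed_perms n" "y \<in> signed_perms n"
  shows "above_arc p q R (weak_inf n x y) \<longleftrightarrow> above_arc p q R x \<and> above_arc p q R y"
  using join_irreducible_of_arc[OF assms(1)] assms(2,3)
  by (metis le_weak_inf_iff weak_inf_mem)

lemma below_arc_weak_sup:
  assumes "signed_arc n p q R" "x \<in> signed_perms n" "y \<in> signed_perms n"
  shows "below_arc p q R (weak_sup n x y) \<longleftrightarrow> below_arc p q R x \<and> below_arc p q R y"
  using above_arc_weak_inf[OF signed_arc_uminus[OF assms(1)] negate_mem[OF assms(2)] negate_mem[OF assms(3)]]
    assms by (simp add: below_arc_iff_above_negate weak_inf_negate weak_sup_mem)

lemma above_arc_mono:
  assumes "weak_le x y" "above_arc p q R x" shows "above_arc p q R y"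
  using assms by (auto simp: above_arc_def dest: weak_leD)

subsection \<open>Contracted arcs\<close>

text \<open>Phrased by a congruent pair that the arc separates rather than by a lower cover, which
  gives the dual notion the same shape. For a join-irreducible it means contraction, by
  \<open>contracts_iff_arc_contracted\<close>.\<close>

definition arc_contracted :: "((int \<Rightarrow> int) \<times> (int \<Rightarrow> int)) set \<Rightarrow> int \<Rightarrow> int \<Rightarrow> int set \<Rightarrow> bool" where
  "arc_contracted \<theta> p q R \<longleftrightarrow> (\<exists>(x, y)\<in>\<theta>. above_arc p q R y \<and> \<not> above_arc p q R x)"

definition arc_contracted_dual :: "((int \<Rightarrow> int) \<times> (int \<Rightarrow> int)) set \<Rightarrow> int \<Rightarrow> int \<Rightarrow> int set \<Rightarrow> bool" where
  "arc_contracted_dual \<theta> p q R \<longleftrightarrow> (\<exists>(x, y)\<in>\<theta>. below_arc p q R x \<and> \<not> below_arc p q R y)"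

lemma weak_congruence_mem:
  assumes "lattice_congruence (weak_order n) \<theta>" "(x, y) \<in> \<theta>"
  shows "x \<in> signed_perms n" "y \<in> signed_perms n"
  using assms by (auto simp: weak_congruence_iff equiv_def)

lemma weak_congruence_refl:
  "lattice_congruence (weak_order n) \<theta> \<Longrightarrow> x \<in> signed_perms n \<Longrightarrow> (x, x) \<in> \<theta>"
  by (auto simp: weak_congruence_iff equiv_def refl_on_def)

lemma weak_congruence_sym:
  "lattice_congruence (weak_order n) \<theta> \<Longrightarrow> (x, y) \<in> \<theta> \<Longrightarrow> (y, x) \<in> \<theta>"
  by (auto simp: weak_congruence_iff equiv_def sym_def)

lemma weak_congruence_inf:
  "lattice_congruence (weak_order n) \<theta> \<Longrightarrow> (x, x') \<in> \<theta> \<Longrightarrow> (y, y') \<in> \<theta> \<Longrightarrow>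
    (weak_inf n x y, weak_inf n x' y') \<in> \<theta>"
  by (auto simp: weak_congruence_iff)

text \<open>Hence every element strictly below the join-irreducible of the arc lacks the inversion \<open>(p, q)\<close>.\<close>

lemma above_arc_if_top_pair:
  assumes arc: "signed_arc n p q R" and u: "u \<in> signed_perms n"
    and le: "inversions u \<subseteq> arc_inversions p q R" and pq: "(p, q) \<in> inversions u"
  shows "above_arc p q R u"
proof -
  have R: "p < q" "p \<noteq> 0" "R \<subseteq> {p<..<q}" "- q \<notin> R" "- p \<notin> R" "0 \<notin> R"
    "\<And>c. c \<in> R \<Longrightarrow> - c \<notin> R"
    "p = - q \<Longrightarrow> 0 < c \<Longrightarrow> c < q \<Longrightarrow> c \<in> R \<or> - c \<in> R" for c
    using arc by (auto simp: signed_arc_def)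
  have ne: "inv u c \<noteq> inv u d" if "c \<noteq> d" for c d using that u by (simp add: signed_perms_inv_eq_iff)
  \<comment> \<open>Below the join-irreducible, \<open>p\<close> stays first among
    \<open>insert p R\<close>, and \<open>q\<close> stays last among the points left of the arc.
    Inverting these two therefore inverts all the pairs demanded; only 0 needs care.\<close>
  have low: "inv u p \<le> inv u a" if "a \<in> insert p R" for a
  proof (cases "a = p")
    case False
    then have "(p, a) \<notin> arc_inversions p q R"
      using R that by (auto simp: arc_inversions_def)
    then have "(p, a) \<notin> inversions u" using le by blast
    then show ?thesis using that False R(3) by (auto simp: mem_inversions)
  qed simp
  have high: "inv u b \<le> inv u q" if "b \<notin> R" "p < b" "b \<le> q" "b = 0 \<longrightarrow> p \<noteq> - q" for b
  proof (cases "b = q")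
    case False
    have "p = - q \<Longrightarrow> - b \<in> R"
      using that False R(8)[of b] R(8)[of "- b"] by force
    then have "(b, q) \<notin> arc_inversions p q R"
      using R that False by (auto simp: arc_inversions_def)
    then have "(b, q) \<notin> inversions u" using le by blast
    then show ?thesis using that False by (auto simp: mem_inversions)
  qed simp
  show ?thesis unfolding above_arc_def
  proof (intro ballI allI impI)
    fix a b assume a: "a \<in> insert p R" and b: "b \<notin> R" "a < b" "b \<le> q"
    then have pb: "p < b" using R(3) by auto
    have "inv u q < inv u p" using pq by (simp add: mem_inversions)
    then have "inv u b < inv u a"
    proof (cases "b = 0 \<and> p = - q")
      \<comment> \<open>For an arc through the origin \<open>(0, q)\<close> is itself an inversion
        of the join-irreducible, so 0 escapes \<open>high\<close>. Here oddness puts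
        \<open>p\<close> at a positive position instead.\<close>
      case True
      then have "inv u q < 0"
        using \<open>inv u q < inv u p\<close> signed_perms_inv_uminus[OF u, of q] by simp
      then have "inv u p > 0" using True signed_perms_inv_uminus[OF u, of q] by simp
      then show ?thesis using low[OF a] True u by simp
    next
      case False
      then show ?thesis using low[OF a] high[of b] b pb \<open>inv u q < inv u p\<close> by linarith
    qed
    then show "(a, b) \<in> inversions u" using b by (simp add: mem_inversions)
  qed
qed

text \<open>Meeting the separated pair with \<open>j\<close> yields \<open>u\<close> congruent to
  \<open>j\<close> and strictly below it. By \<open>only\<close>, the top pair
  \<open>(p', q')\<close> and its companions are all that keeps \<open>j\<close> from lying below
  the second arc, and \<open>u\<close> has lost them. So the second arc separates \<open>u\<close>
  from \<open>j\<close>.\<close>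

lemma arc_contracted_step:
  assumes cong: "lattice_congruence (weak_order n) \<theta>"
    and arc: "signed_arc n p' q' R'"
    and pq: "p \<le> p'" "p' \<notin> R" "q' \<in> insert q R"
    and only: "\<And>a b. (a, b) \<in> arc_inversions p' q' R' \<Longrightarrow> p \<le> a \<Longrightarrow> a \<notin> R \<Longrightarrow> b \<in> insert q R \<Longrightarrow>
      (a, b) \<in> {(p', q'), (- q', - p')} \<or> p' = - q' \<and> (a, b) \<in> {(0, q'), (- q', 0)}"
    and contr: "arc_contracted \<theta> p' q' R'"
  shows "arc_contracted_dual \<theta> p q R"
proof -
  obtain x y where xy: "(x, y) \<in> \<theta>" "above_arc p' q' R' y" "\<not> above_arc p' q' R' x"
    using contr by (auto simp: arc_contracted_def)
  note mem = weak_congruence_mem[OF cong xy(1)]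
  obtain j where j: "j \<in> signed_perms n" "inversions j = arc_inversions p' q' R'"
    and above: "\<And>x. x \<in> signed_perms n \<Longrightarrow> above_arc p' q' R' x \<longleftrightarrow> weak_le j x"
    using join_irreducible_of_arc[OF arc] by metis
  define u where "u = weak_inf n j x"
  have u: "u \<in> signed_perms n" "weak_le u j" "weak_le u x"
    using j mem le_weak_inf_iff[OF j(1) mem(1), of u] by (auto simp: u_def weak_inf_mem)
  have "weak_inf n j y = j" using above xy mem j by (simp add: weak_inf_absorb)
  then have uj: "(u, j) \<in> \<theta>"
    using weak_congruence_inf[OF cong weak_congruence_refl[OF cong j(1)] xy(1)] by (simp add: u_def)
  have "\<not> above_arc p' q' R' u" using xy(3) above_arc_mono[OF u(3)] by blast
  then have "(p', q') \<notin> inversions u"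
    using above_arc_if_top_pair[OF arc u(1)] u(2) j(2) by (auto simp: weak_le_def)
  then have n1: "(- q', - p') \<notin> inversions u" "(p', q') \<notin> inversions u" using u(1) by (auto simp: inversions_uminus)
  \<comment> \<open>The two pairs with 0 are mirror images, and together they would give
    \<open>(- q', q')\<close> by transitivity.\<close>
  have n2: "(0, q') \<notin> inversions u \<and> (- q', 0) \<notin> inversions u" if "p' = - q'"
  proof -
    have "(0, q') \<in> inversions u \<longleftrightarrow> (- q', 0) \<in> inversions u"
      using inversions_uminus[OF u(1), of q' 0] by simp
    then show ?thesis using n1 that inversions_trans[of "- q'" 0 u q'] by auto
  qed
  have "(a, b) \<notin> inversions u" if "b \<in> insert q R" "a \<notin> R" "p \<le> a" for a b
  proof
    assume ab: "(a, b) \<in> inversions u"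
    then have "(a, b) \<in> arc_inversions p' q' R'" using u(2) j(2) by (auto simp: weak_le_def)
    from only[OF this] that ab n1 n2 show False by auto
  qed
  then have "below_arc p q R u" by (auto simp: below_arc_def)
  moreover have "\<not> below_arc p q R j"
  proof -
    have "(p', q') \<in> arc_inversions p' q' R'"
      using arc by (auto simp: arc_inversions_def signed_arc_def)
    moreover have "p' < q'" using arc by (simp add: signed_arc_def)
    ultimately show ?thesis using pq j(2) by (auto simp: below_arc_def)
  qed
  ultimately show ?thesis using uj by (auto simp: arc_contracted_dual_def)
qed

text \<open>Among the pairs forbidden below an arc, the join-irreducible of the same arc has only
  the top pair and its companions, so the previous step applies with both arcs equal.\<close>

lemma arc_contracted_imp_dual:
  assumes "lattice_congruence (weak_order n) \<theta>" and arc: "signed_arc n p q R"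
    and "arc_contracted \<theta> p q R"
  shows "arc_contracted_dual \<theta> p q R"
proof (rule arc_contracted_step[OF assms(1,2) _ _ _ _ assms(3)])
  have R: "p < q" "R \<subseteq> {p<..<q}" "- q \<notin> R" "- p \<notin> R" "\<And>c. c \<in> R \<Longrightarrow> - c \<notin> R"
    "p = - q \<Longrightarrow> 0 < c \<Longrightarrow> c < q \<Longrightarrow> c \<in> R \<or> - c \<in> R" for c
    using arc by (auto simp: signed_arc_def)
  fix a b assume ab: "(a, b) \<in> arc_inversions p q R" "p \<le> a" "a \<notin> R" "b \<in> insert q R"
  have "p = - q \<Longrightarrow> p < a \<Longrightarrow> a < q \<Longrightarrow> a \<noteq> 0 \<Longrightarrow> - a \<in> R"
    using R(6)[of a] R(6)[of "- a"] ab(3) by (cases "0 < a") auto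
  moreover have "- b \<notin> R" using R ab(4) by auto
  then consider "a = p" "b \<notin> insert p R" "b \<le> q" | "b = - p" "- a \<notin> insert p R" "- q \<le> a" "a < b"
    | "a = p" "b = - p"
    using ab(1) \<open>a \<notin> R\<close> by (auto simp: arc_inversions_def)
  then show "(a, b) \<in> {(p, q), (- q, - p)} \<or> p = - q \<and> (a, b) \<in> {(0, q), (- q, 0)}"
  proof cases
    case 2
    then have "p = - q" using ab(4) R(4) by auto
    then show ?thesis using 2 calculation ab(2) by force
  qed (use ab(4) R(4) in auto)
qed (use arc in \<open>auto simp: signed_arc_def\<close>)

lemma arc_contracted_dual_negate:
  assumes cong: "lattice_congruence (weak_order n) \<theta>" and arc: "signed_arc n p q R"
  shows "arc_contracted_dual \<theta> p q R \<longleftrightarrow>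
    arc_contracted {(x, y). (negate n x, negate n y) \<in> \<theta>} (- q) (- p) (uminus ` R)"
    (is "?l \<longleftrightarrow> ?r")
proof
  assume ?l
  then obtain x y where xy: "(x, y) \<in> \<theta>" "below_arc p q R x" "\<not> below_arc p q R y"
    by (auto simp: arc_contracted_dual_def)
  then show ?r
    using below_arc_iff_above_negate[OF arc] weak_congruence_mem[OF cong xy(1)] weak_congruence_sym[OF cong xy(1)]
    unfolding arc_contracted_def by (intro bexI[of _ "(negate n y, negate n x)"]) auto
next
  assume ?r
  then obtain x y where xy: "(negate n x, negate n y) \<in> \<theta>"
    "above_arc (- q) (- p) (uminus ` R) y" "\<not> above_arc (- q) (- p) (uminus ` R) x"
    by (auto simp: arc_contracted_def)
  then show ?l
    using below_arc_iff_above_negate[OF arc] weak_congruence_mem[OF cong xy(1)] weak_congruence_sym[OF cong xy(1)]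
    unfolding arc_contracted_dual_def by (intro bexI[of _ "(negate n y, negate n x)"]) auto
qed

lemma arc_contracted_negate:
  assumes cong: "lattice_congruence (weak_order n) \<theta>" and arc: "signed_arc n p q R"
  shows "arc_contracted \<theta> p q R \<longleftrightarrow>
    arc_contracted_dual {(x, y). (negate n x, negate n y) \<in> \<theta>} (- q) (- p) (uminus ` R)"
  using arc_contracted_dual_negate[OF weak_congruence_negate[OF cong] signed_arc_uminus[OF arc]]
  by (simp add: image_image)

text \<open>The converse implication is the direct one for the negated congruence and the negated
  arc.\<close>

lemma arc_contracted_dual_iff:
  assumes cong: "lattice_congruence (weak_order n) \<theta>" and arc: "signed_arc n p q R"
  shows "arc_contracted_dual \<theta> p q R \<longleftrightarrow> arc_contracted \<theta> p q R"
  using arc_contracted_imp_dual[OF cong arc]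
    arc_contracted_imp_dual[OF weak_congruence_negate[OF cong] signed_arc_uminus[OF arc]]
    arc_contracted_dual_negate[OF cong arc] arc_contracted_negate[OF cong arc] by blast

section \<open>Elementary forcing rules\<close>

definition arc_forces :: "nat \<Rightarrow> int \<Rightarrow> int \<Rightarrow> int set \<Rightarrow> int \<Rightarrow> int \<Rightarrow> int set \<Rightarrow> bool" where
  "arc_forces n p' q' R' p q R \<longleftrightarrow>
     (\<forall>\<theta>. lattice_congruence (weak_order n) \<theta> \<longrightarrow> arc_contracted \<theta> p' q' R' \<longrightarrow> arc_contracted \<theta> p q R)"

lemma arc_forces_trans:
  "arc_forces n p\<^sub>1 q\<^sub>1 R\<^sub>1 p\<^sub>2 q\<^sub>2 R\<^sub>2 \<Longrightarrow> arc_forces n p\<^sub>2 q\<^sub>2 R\<^sub>2 p\<^sub>3 q\<^sub>3 R\<^sub>3 \<Longrightarrow>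
    arc_forces n p\<^sub>1 q\<^sub>1 R\<^sub>1 p\<^sub>3 q\<^sub>3 R\<^sub>3"
  by (auto simp: arc_forces_def)

lemma arc_forces_dual:
  assumes "signed_arc n p' q' R'" "signed_arc n p q R"
    and "arc_forces n (- q') (- p') (uminus ` R') (- q) (- p) (uminus ` R)"
  shows "arc_forces n p' q' R' p q R"
  unfolding arc_forces_def
proof (intro allI impI)
  fix \<theta> assume cong: "lattice_congruence (weak_order n) \<theta>" and c: "arc_contracted \<theta> p' q' R'"
  let ?\<theta> = "{(x, y). (negate n x, negate n y) \<in> \<theta>}"
  note cong' = weak_congruence_negate[OF cong]
  have "arc_contracted ?\<theta> (- q') (- p') (uminus ` R')"
    using c arc_contracted_dual_iff[OF cong assms(1)] arc_contracted_dual_negate[OF cong assms(1)] by blast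
  then have "arc_contracted ?\<theta> (- q) (- p) (uminus ` R)"
    using assms(3) cong' by (auto simp: arc_forces_def)
  then show "arc_contracted \<theta> p q R"
    using arc_contracted_dual_iff[OF cong assms(2)] arc_contracted_dual_negate[OF cong assms(2)] by blast
qed

text \<open>
  The last hypothesis keeps the inversions that \<open>arc_inversions\<close> adds by symmetry and transitivity
  from obstructing the second arc.
\<close>

lemma arc_forces_right:
  assumes arc': "signed_arc n p' q' (R \<inter> {p'<..<q'})" and arc: "signed_arc n p q R"
    and sub: "p \<le> p'" "q' \<le> q" and p': "p' \<notin> R" and q': "q' \<in> insert q R"
    and opp: "- p' \<notin> insert q R \<or> p' = - q' \<or> p = - q \<and> q' = q \<and> 0 < p' \<or> p = - q \<and> p' = p \<and> q' < 0"
  shows "arc_forces n p' q' (R \<inter> {p'<..<q'}) p q R"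
  unfolding arc_forces_def
proof (intro allI impI)
  fix \<theta> assume cong: "lattice_congruence (weak_order n) \<theta>"
    and c: "arc_contracted \<theta> p' q' (R \<inter> {p'<..<q'})"
  have "arc_contracted_dual \<theta> p q R"
  proof (rule arc_contracted_step[OF cong arc' sub(1) p' q' _ c])
    have R: "p < q" "R \<subseteq> {p<..<q}" "- q \<notin> R" "- p \<notin> R" "0 \<notin> R" "\<And>c. c \<in> R \<Longrightarrow> - c \<notin> R"
      "p = - q \<Longrightarrow> 0 < c \<Longrightarrow> c < q \<Longrightarrow> c \<in> R \<or> - c \<in> R" for c
      using arc by (auto simp: signed_arc_def)
    have R': "p' < q'" "p' \<noteq> 0" "q' \<noteq> 0" "p' = - q' \<Longrightarrow> 0 < c \<Longrightarrow> c < q' \<Longrightarrow> c \<in> R \<or> - c \<in> R" for c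
      using arc' by (auto simp: signed_arc_def)
    fix a b assume ab: "(a, b) \<in> arc_inversions p' q' (R \<inter> {p'<..<q'})" "p \<le> a" "a \<notin> R" "b \<in> insert q R"
    have "- b \<notin> R" using R ab by auto
    have "a < b" using ab by (simp add: arc_inversions_def)
    \<comment> \<open>As neither \<open>a\<close> nor \<open>- b\<close> is in \<open>R\<close>, the
      clauses of \<open>arc_inversions\<close> leave only \<open>a = p'\<close> or
      \<open>b = - p'\<close>. The pairs with \<open>b = - p'\<close> come from symmetry and
      transitivity, and \<open>opp\<close> is what controls them.\<close>
    from ab(1) consider
        (1) "a = p'" "b \<notin> insert p' (R \<inter> {p'<..<q'})" "b \<le> q'"
      | (2) "b = - p'" "- a \<noteq> p'" "- a \<notin> R \<inter> {p'<..<q'}" "- q' \<le> a"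
      | (3) "0 < q'" "a = p'" "b = - p'"
      using \<open>a \<notin> R\<close> \<open>- b \<notin> R\<close> by (auto simp: arc_inversions_def)
    then show "(a, b) \<in> {(p', q'), (- q', - p')} \<or> p' = - q' \<and> (a, b) \<in> {(0, q'), (- q', 0)}"
    proof cases
      case 1
      then show ?thesis using ab sub q' \<open>a < b\<close> by auto
    next
      case 2
      show ?thesis
      proof (cases "a = - q'")
        case False
        have "- a \<notin> R" using 2 False \<open>a < b\<close> by auto
        have "p' = - q' \<or> p = - q" using opp 2(1) ab(4) by auto
        then have "a = 0 \<and> p' = - q'"
          using R'(4)[of a] R'(4)[of "- a"] R(7)[of a] R(7)[of "- a"] opp 2 ab \<open>- a \<notin> R\<close> \<open>a < b\<close> False R' sub
          by (smt (verit, ccfv_threshold))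
        then show ?thesis using 2 by simp
      qed (use 2 in simp)
    next
      case 3
      then show ?thesis using opp ab(4) R' \<open>a < b\<close> by auto
    qed
  qed
  then show "arc_contracted \<theta> p q R" using arc_contracted_dual_iff[OF cong arc] by blast
qed

text \<open>The dual of \<open>arc_forces_right\<close>: negation exchanges the endpoints, so now
  the lower one may lie right of the arc and the upper one left.\<close>

lemma arc_forces_left:
  assumes arc': "signed_arc n p' q' (R \<inter> {p'<..<q'})" and arc: "signed_arc n p q R"
    and sub: "p \<le> p'" "q' \<le> q" and p': "p' \<in> insert p R" and q': "q' \<notin> R"
    and opp: "- q' \<notin> insert p R \<or> p' = - q' \<or> p = - q \<and> p' = p \<and> q' < 0 \<or> p = - q \<and> q' = q \<and> 0 < p'"
  shows "arc_forces n p' q' (R \<inter> {p'<..<q'}) p q R"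
proof (rule arc_forces_dual[OF arc' arc])
  have m: "c \<in> uminus ` R \<longleftrightarrow> - c \<in> R" for c by force
  have eq: "uminus ` (R \<inter> {p'<..<q'}) = uminus ` R \<inter> {- q'<..<- p'}" by force
  show "arc_forces n (- q') (- p') (uminus ` (R \<inter> {p'<..<q'})) (- q) (- p) (uminus ` R)"
    unfolding eq
  proof (rule arc_forces_right)
    show "signed_arc n (- q') (- p') (uminus ` R \<inter> {- q'<..<- p'})"
      using signed_arc_uminus[OF arc'] by (simp add: eq)
  qed (use assms signed_arc_uminus[OF arc] in \<open>auto simp: m\<close>)
qed

subsection \<open>Subarcs force\<close>

text \<open>The last condition says that arcs through the origin have no long subarcs.\<close>

definition signed_subarc :: "nat \<Rightarrow> int \<Rightarrow> int \<Rightarrow> int \<Rightarrow> int \<Rightarrow> int set \<Rightarrow> bool" where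
  "signed_subarc n p' q' p q R \<longleftrightarrow> p \<le> p' \<and> q' \<le> q \<and> signed_arc n p' q' (R \<inter> {p'<..<q'}) \<and>
     (p = - q \<longrightarrow> p' < 0 \<longrightarrow> 0 < q' \<longrightarrow> p' = - q')"

lemma signed_arcD:
  assumes "signed_arc n p q R"
  shows "p < q" "p \<noteq> 0" "q \<noteq> 0" "- int n \<le> p" "q \<le> int n" "R \<subseteq> {p<..<q}" "0 \<notin> R" "- p \<notin> R" "- q \<notin> R"
    "c \<in> R \<Longrightarrow> - c \<notin> R" "p = - q \<Longrightarrow> 0 < c \<Longrightarrow> c < q \<Longrightarrow> c \<in> R \<or> - c \<in> R"
  using assms by (simp_all add: signed_arc_def)

text \<open>For an arc across the axis the negative of a new endpoint might lie in the restricted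
  right set; the two implications exclude this. Arcs through the origin are left to
  \<open>signed_arc_through_origin\<close>.\<close>

lemma signed_arc_restrict:
  assumes "signed_arc n p q R" "p \<le> p'" "q' \<le> q" "p' < q'" "p' \<noteq> 0" "q' \<noteq> 0"
    "- p' \<in> R \<Longrightarrow> p' < - p' \<Longrightarrow> q' \<le> - p'" "- q' \<in> R \<Longrightarrow> - q' < q' \<Longrightarrow> - q' \<le> p'" "p' \<noteq> - q'"
  shows "signed_arc n p' q' (R \<inter> {p'<..<q'})"
  using assms signed_arcD[OF assms(1)] unfolding signed_arc_def by force

lemma mem_uminus_image: "c \<in> uminus ` A \<longleftrightarrow> - c \<in> A" for c :: int
  by force

lemma uminus_image_Int_interval:
  "uminus ` (R \<inter> {p<..<q}) = uminus ` R \<inter> {- q<..<- p}" for p q :: int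
  by force

lemma signed_arc_uminus_iff:
  "signed_arc n (- q) (- p) (uminus ` R) \<longleftrightarrow> signed_arc n p q R"
  using signed_arc_uminus[of n p q R] signed_arc_uminus[of n "- q" "- p" "uminus ` R"]
  by (auto simp: image_image)

lemma signed_subarc_uminus:
  "signed_subarc n (- q') (- p') (- q) (- p) (uminus ` R) \<longleftrightarrow> signed_subarc n p' q' p q R"
  unfolding signed_subarc_def uminus_image_Int_interval[symmetric] signed_arc_uminus_iff by auto

text \<open>An endpoint that stays put meets the side conditions of both elementary rules, since
  \<open>p\<close> is outside \<open>R\<close> and in \<open>insert p R\<close>. So the side on
  which \<open>q'\<close> lies decides which rule applies.\<close>

lemma arc_forces_raise:
  assumes arc: "signed_arc n p q R" and arc': "signed_arc n p q' (R \<inter> {p<..<q'})"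
    and "q' \<le> q" "p \<noteq> - q'" "p \<noteq> - q \<or> q' < 0" "q' \<in> R \<or> - q' \<notin> R \<or> 0 < q' \<or> p = - q"
  shows "arc_forces n p q' (R \<inter> {p<..<q'}) p q R"
proof (cases "q' \<in> insert q R")
  case True
  have "- p \<notin> insert q R \<or> p = - q \<and> q' < 0" using assms(5) signed_arcD(8)[OF arc] by auto
  then show ?thesis using True arc arc' \<open>q' \<le> q\<close> signed_arcD(6)[OF arc] by (intro arc_forces_right) auto
next
  case False
  have "- q' \<in> R \<Longrightarrow> 0 < q' \<Longrightarrow> p < - q' \<and> - q' < q'"
    using signed_arcD(6)[OF arc] by auto
  then have "- q' \<notin> insert p R \<or> p = - q \<and> q' < 0"
    using False assms(4-6) signed_arcD(9)[OF arc'] by auto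
  then show ?thesis using False arc arc' \<open>q' \<le> q\<close> by (intro arc_forces_left) auto
qed

lemma arc_forces_lower:
  assumes arc: "signed_arc n p q R" and arc': "signed_arc n p' q (R \<inter> {p'<..<q})"
    and "p \<le> p'" "p' \<noteq> - q" "p \<noteq> - q \<or> 0 < p'" "p' \<in> R \<or> - p' \<notin> R \<or> p' < 0 \<or> p = - q"
  shows "arc_forces n p' q (R \<inter> {p'<..<q}) p q R"
proof (rule arc_forces_dual[OF arc' arc])
  show "arc_forces n (- q) (- p') (uminus ` (R \<inter> {p'<..<q})) (- q) (- p) (uminus ` R)"
    unfolding uminus_image_Int_interval using assms
    by (intro arc_forces_raise)
      (auto simp: signed_arc_uminus_iff mem_uminus_image uminus_image_Int_interval[symmetric])
qed

lemma restrict_interval: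
  "a \<le> c \<Longrightarrow> d \<le> b \<Longrightarrow> R \<inter> {a<..<b} \<inter> {c<..<d} = R \<inter> {c<..<d}" for a b c d :: int
  by auto

lemma arc_forces_via:
  assumes "a \<le> p'" "q' \<le> b" "arc_forces n p' q' (R \<inter> {a<..<b} \<inter> {p'<..<q'}) a b (R \<inter> {a<..<b})"
    "arc_forces n a b (R \<inter> {a<..<b}) p q R"
  shows "arc_forces n p' q' (R \<inter> {p'<..<q'}) p q R"
  using assms arc_forces_trans by (simp add: restrict_interval)

text \<open>The top is raised first, which is harmless above the axis; afterwards the bottom is
  lowered.\<close>

lemma arc_forces_upper_half:
  assumes arc: "signed_arc n p q R" and sub: "signed_subarc n p' q' p q R" and pos: "0 < p'"
  shows "arc_forces n p' q' (R \<inter> {p'<..<q'}) p q R"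
proof -
  have arc': "signed_arc n p' q' (R \<inter> {p'<..<q'})" and le: "p \<le> p'" "q' \<le> q" "p' < q'"
    using sub by (auto simp: signed_subarc_def signed_arc_def)
  have arc1: "signed_arc n p' q (R \<inter> {p'<..<q})"
    using pos le signed_arcD(6,9)[OF arc] by (intro signed_arc_restrict[OF arc]) auto
  have 1: "arc_forces n p' q' (R \<inter> {p'<..<q} \<inter> {p'<..<q'}) p' q (R \<inter> {p'<..<q})"
    using arc1 arc' le pos by (intro arc_forces_raise) (auto simp: restrict_interval)
  have 2: "arc_forces n p' q (R \<inter> {p'<..<q}) p q R"
  proof (cases "p' \<in> R \<or> - p' \<notin> R \<or> p = - q")
    case True
    then show ?thesis using arc arc1 le pos by (intro arc_forces_lower) auto
  next
    \<comment> \<open>Lowering from \<open>p'\<close> is obstructed by \<open>- p'\<close>, which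
      lies right of the arc while \<open>p'\<close> lies left. Stopping at \<open>- p'\<close> on
      the way removes the obstruction: it is an endpoint in the first move and a point of
      \<open>R\<close> in the second.\<close>
    case False
    have arc2: "signed_arc n (- p') q (R \<inter> {- p'<..<q})"
      using pos le False signed_arcD(2,6,9)[OF arc] by (intro signed_arc_restrict[OF arc]) auto
    have "arc_forces n p' q (R \<inter> {- p'<..<q} \<inter> {p'<..<q}) (- p') q (R \<inter> {- p'<..<q})"
      using arc1 arc2 le pos by (intro arc_forces_lower) (auto simp: restrict_interval)
    moreover have "arc_forces n (- p') q (R \<inter> {- p'<..<q}) p q R"
      using arc arc2 le pos False signed_arcD(6)[OF arc] by (intro arc_forces_lower) auto
    ultimately show ?thesis by (rule arc_forces_via[rotated 2]) (use le pos in auto)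
  qed
  show ?thesis using arc_forces_via[OF _ _ 1 2] le by simp
qed

lemma arc_forces_lower_half:
  assumes arc: "signed_arc n p q R" and sub: "signed_subarc n p' q' p q R" and neg: "q' < 0"
  shows "arc_forces n p' q' (R \<inter> {p'<..<q'}) p q R"
proof (rule arc_forces_dual[OF _ arc])
  show "signed_arc n p' q' (R \<inter> {p'<..<q'})" using sub by (simp add: signed_subarc_def)
  show "arc_forces n (- q') (- p') (uminus ` (R \<inter> {p'<..<q'})) (- q) (- p) (uminus ` R)"
    unfolding uminus_image_Int_interval
    by (rule arc_forces_upper_half) (use assms in \<open>simp_all add: signed_arc_uminus_iff signed_subarc_uminus\<close>)
qed

lemma arc_forces_through_origin:
  assumes arc: "signed_arc n p q R" and sub: "signed_subarc n (- c) c p q R"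
  shows "arc_forces n (- c) c (R \<inter> {- c<..<c}) p q R"
proof -
  have arc': "signed_arc n (- c) c (R \<inter> {- c<..<c})" and le: "p \<le> - c" "c \<le> q" "0 < c"
    using sub by (auto simp: signed_subarc_def signed_arc_def)
  have opp: "c \<in> R \<Longrightarrow> - c \<notin> R" using arc by (auto simp: signed_arc_def)
  have "c = q \<Longrightarrow> - c \<notin> R" using arc by (auto simp: signed_arc_def)
  then consider "- c \<notin> R" "c \<in> insert q R" | "- c \<in> insert p R" "c \<notin> R"
    | "c \<notin> R" "- c \<notin> R" "c < q" "p < - c" using opp le
    by (cases "c \<in> R"; cases "- c \<in> R"; cases "c = q"; cases "p = - c") auto
  then show ?thesis
  proof cases
    case 1 then show ?thesis using arc arc' le by (intro arc_forces_right) auto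
  next
    case 2 then show ?thesis using arc arc' le by (intro arc_forces_left) auto
  next
    \<comment> \<open>Both \<open>c\<close> and \<open>- c\<close> lie left of the arc and neither
      is an endpoint, so neither rule moves both ends at once; the chain goes through the arc from
      \<open>- c\<close> to \<open>q\<close>. Such a \<open>c\<close> also rules out
      \<open>p = - q\<close>.\<close>
    case 3
    have arc1: "signed_arc n (- c) q (R \<inter> {- c<..<q})"
      using le 3 signed_arcD(9)[OF arc] by (intro signed_arc_restrict[OF arc]) auto
    have "arc_forces n (- c) c (R \<inter> {- c<..<q} \<inter> {- c<..<c}) (- c) q (R \<inter> {- c<..<q})"
      using arc1 arc' le 3 by (intro arc_forces_left) (auto simp: restrict_interval)
    moreover have "p \<noteq> - q"
      using signed_arcD(11)[OF arc, of c] 3 le by auto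
    then have "arc_forces n (- c) q (R \<inter> {- c<..<q}) p q R"
      using arc arc1 le 3 by (intro arc_forces_lower) auto
    ultimately show ?thesis by (rule arc_forces_via[rotated 2]) (use le in auto)
  qed
qed

text \<open>The intermediate arc must again be a signed arc not through the origin. Moving the top
  first fails if \<open>p' = - q\<close> or \<open>- p'\<close> is in \<open>R\<close>; then
  \<open>q' < - p'\<close>, and moving the bottom first succeeds.\<close>

lemma arc_forces_crossing:
  assumes arc: "signed_arc n p q R" and sub: "signed_subarc n p' q' p q R"
    and "p' < 0" "0 < q'" "p' \<noteq> - q'"
  shows "arc_forces n p' q' (R \<inter> {p'<..<q'}) p q R"
proof -
  have arc': "signed_arc n p' q' (R \<inter> {p'<..<q'})" and le: "p \<le> p'" "q' \<le> q" and pq: "p \<noteq> - q"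
    using sub assms(3-5) by (auto simp: signed_subarc_def signed_arc_def)
  have "(p' \<noteq> - q \<and> (- p' \<in> R \<longrightarrow> q \<le> - p')) \<or> (q' \<noteq> - p \<and> (- q' \<in> R \<longrightarrow> - q' \<le> p))"
  proof -
    have 1: "q' \<le> - p'" if "- p' \<in> R" using signed_arcD(8)[OF arc'] assms(3-5) that by (auto simp: not_le)
    have 2: "- q' \<le> p'" if "- q' \<in> R" using signed_arcD(9)[OF arc'] assms(3-5) that by (auto simp: not_le)
    show ?thesis
    proof (cases "p' = - q \<or> - p' \<in> R")
      case True
      then have "q' < - p'" using 1 le assms(5) by force
      then have "q' \<noteq> - p" "- q' \<notin> R" using le 2 by force+
      then show ?thesis by simp
    qed simp
  qed
  then show ?thesis
  proof
    assume *: "p' \<noteq> - q \<and> (- p' \<in> R \<longrightarrow> q \<le> - p')"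
    have arc1: "signed_arc n p' q (R \<inter> {p'<..<q})"
      using le assms(3-5) * signed_arcD(9)[OF arc] by (intro signed_arc_restrict[OF arc]) auto
    have "arc_forces n p' q' (R \<inter> {p'<..<q} \<inter> {p'<..<q'}) p' q (R \<inter> {p'<..<q})"
      using arc1 arc' le assms(3-5) * by (intro arc_forces_raise) (auto simp: restrict_interval)
    moreover have "arc_forces n p' q (R \<inter> {p'<..<q}) p q R"
      using arc arc1 le assms(3-5) * pq by (intro arc_forces_lower) auto
    ultimately show ?thesis by (rule arc_forces_via[rotated 2]) (use le in auto)
  next
    assume *: "q' \<noteq> - p \<and> (- q' \<in> R \<longrightarrow> - q' \<le> p)"
    have arc1: "signed_arc n p q' (R \<inter> {p<..<q'})"
      using le assms(3-5) * signed_arcD(8)[OF arc] by (intro signed_arc_restrict[OF arc]) auto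
    have "arc_forces n p' q' (R \<inter> {p<..<q'} \<inter> {p'<..<q'}) p q' (R \<inter> {p<..<q'})"
      using arc1 arc' le assms(3-5) * by (intro arc_forces_lower) (auto simp: restrict_interval)
    moreover have "arc_forces n p q' (R \<inter> {p<..<q'}) p q R"
      using arc arc1 le assms(3-5) * pq by (intro arc_forces_raise) auto
    ultimately show ?thesis by (rule arc_forces_via[rotated 2]) (use le in auto)
  qed
qed

theorem arc_forces_if_signed_subarc:
  assumes "signed_arc n p q R" "signed_subarc n p' q' p q R"
  shows "arc_forces n p' q' (R \<inter> {p'<..<q'}) p q R"
proof -
  have "p' < q'" "p' \<noteq> 0" "q' \<noteq> 0" using assms(2) by (auto simp: signed_subarc_def signed_arc_def)
  then consider "0 < p'" | "q' < 0" | "p' < 0" "0 < q'" by linarith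
  then show ?thesis
  proof cases
    case 3
    then show ?thesis using arc_forces_crossing[OF assms] arc_forces_through_origin[of n p q R q'] assms
      by (cases "p' = - q'") auto
  qed (use assms arc_forces_upper_half arc_forces_lower_half in auto)
qed

subsection \<open>The congruence of an arc\<close>

text \<open>One cut \<open>k\<close> in the positions replaces the comparison of all pairs. It will
  be the position of \<open>b\<close>, or 0 for arcs found around the origin.\<close>

lemma above_arcI_pivot:
  assumes "\<And>e. e \<in> insert a (R \<inter> {a<..<b}) \<Longrightarrow> k < inv x e"
    and "\<And>d. d \<notin> R \<or> d = b \<Longrightarrow> a < d \<Longrightarrow> d \<le> b \<Longrightarrow> inv x d \<le> k"
  shows "above_arc a b (R \<inter> {a<..<b}) x"
  unfolding above_arc_def
proof (intro ballI allI impI)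
  fix e d assume e: "e \<in> insert a (R \<inter> {a<..<b})" and d: "d \<notin> R \<inter> {a<..<b}" "e < d" "d \<le> b"
  have "a < d" using e d by auto
  then have "inv x d \<le> k" using assms(2)[of d] d by fastforce
  then show "(e, d) \<in> inversions x" using assms(1)[OF e] d by (simp add: mem_inversions)
qed

lemma minimal_pair:
  assumes "P a b" and "\<And>a b. P a b \<Longrightarrow> a < b"
  obtains a b :: int where "P a b" "\<And>c d. P c d \<Longrightarrow> b - a \<le> d - c"
proof -
  have "\<exists>ab. (\<lambda>(a, b). P a b) ab \<and> (\<forall>cd. (\<lambda>(a, b). P a b) cd \<longrightarrow>
      (\<lambda>(a, b). nat (b - a)) ab \<le> (\<lambda>(a, b). nat (b - a)) cd)"
    by (rule ex_has_least_nat[of _ "(a, b)"]) (use assms(1) in simp)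
  then obtain a b where ab: "P a b" "\<And>c d. P c d \<Longrightarrow> nat (b - a) \<le> nat (d - c)" by auto
  show ?thesis
  proof (rule that[OF ab(1)])
    fix c d assume "P c d"
    then show "b - a \<le> d - c" using ab(2)[of c d] assms(2)[of c d] by (simp add: nat_le_eq_zle)
  qed
qed

lemma signed_arc_through_origin:
  assumes arc: "signed_arc n p q R" and "p \<le> - b" "b \<le> q" "0 < b" "- b \<notin> R"
    and "\<And>c. 0 < c \<Longrightarrow> c < b \<Longrightarrow> c \<in> R \<or> - c \<in> R"
  shows "signed_arc n (- b) b (R \<inter> {- b<..<b})"
proof -
  have "c \<in> R \<Longrightarrow> - c \<notin> R" for c using signed_arcD[OF arc] by blast
  then show ?thesis using assms signed_arcD[OF arc] by (simp add: signed_arc_def)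
qed

text \<open>Minimality of a bad pair places the left points between its members no later than
  \<open>b\<close> and the right points no earlier than \<open>a\<close>. The remaining work is near
  the origin: the lower member may be 0, and an arc through the origin has no long subarcs.\<close>

lemma exists_subarc_above:
  assumes arc: "signed_arc n p q R" and x: "x \<in> signed_perms n" and nb: "\<not> below_arc p q R x"
  obtains r s where "signed_subarc n r s p q R" "r \<notin> R" "s \<in> insert q R"
    "above_arc r s (R \<inter> {r<..<s}) x"
proof -
  note R = signed_arcD[OF arc]
  define bad where "bad a b \<longleftrightarrow> p \<le> a \<and> a \<notin> R \<and> a < b \<and> b \<in> insert q R \<and> inv x b < inv x a" for a b
  obtain a\<^sub>0 b\<^sub>0 where bad0: "bad a\<^sub>0 b\<^sub>0"
    using nb by (auto simp: below_arc_def bad_def mem_inversions)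
  have neg: "inv x (- c) = - inv x c" for c using x by (rule signed_perms_inv_uminus)
  have zero: "inv x 0 = 0" "\<And>c. inv x c = 0 \<longleftrightarrow> c = 0"
    using x by (auto simp: signed_perms_inv_eq_zero_iff)
  have upper: "b \<le> q" "- b \<notin> R" if "b \<in> insert q R" for b using R that by auto
  show ?thesis
  proof (cases "p = - q")
    case False
    obtain a b where bad: "bad a b" and min: "\<And>c d. bad c d \<Longrightarrow> b - a \<le> d - c"
      using bad0 by (rule minimal_pair) (simp_all add: bad_def)
    have ab: "p \<le> a" "a \<notin> R" "a < b" "b \<in> insert q R" "inv x b < inv x a"
      using bad by (auto simp: bad_def)
    note b = upper[OF ab(4)]
    have low: "inv x d \<le> inv x b" if "d \<notin> R" "a < d" "d < b" for d
      by (rule ccontr) (use min[of d b] that ab in \<open>auto simp: bad_def\<close>)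
    have high: "inv x a \<le> inv x c" if "c \<in> R" "a < c" "c < b" for c
      by (rule ccontr) (use min[of a c] that ab in \<open>auto simp: bad_def\<close>)
    have above: "above_arc a b (R \<inter> {a<..<b}) x"
    proof (rule above_arcI_pivot[where k = "inv x b"])
      fix e assume "e \<in> insert a (R \<inter> {a<..<b})"
      then show "inv x b < inv x e" using high[of e] ab(5) by auto
    next
      fix d assume "d \<notin> R \<or> d = b" "a < d" "d \<le> b"
      then show "inv x d \<le> inv x b" using low[of d] by (cases "d = b") auto
    qed
    show ?thesis
    proof (cases "a = 0")
      case True
      have negb: "inv x b < 0" "0 < b" using ab True zero by auto
      have low': "inv x d < 0" if "d \<notin> R \<or> d = b" "0 < d" "d \<le> b" for d
        using low[of d] that negb True by (cases "d = b") auto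
      have high': "0 < inv x e" if "e \<in> R" "0 < e" "e < b" for e
        using high[of e] that True zero(1) zero(2)[of e] by auto
      \<comment> \<open>The candidates \<open>- c\<close> for replacing the lower endpoint 0;
        \<open>c = - p\<close> may be among them. For the smallest \<open>c\<close>, every point of
        \<open>(- c, 0)\<close> outside \<open>R\<close> has its negative in \<open>R\<close>, and
        so stands at a negative position.\<close>
      define middle where "middle c \<longleftrightarrow> 0 < c \<and> c < b \<and> c \<notin> R \<and> - c \<notin> R \<and> p \<le> - c" for c
      have opp: "0 < inv x e" if "e \<in> R" "e < 0" "- b < e" for e
        using low'[of "- e"] R(10)[of e] that by (simp add: neg)
      show ?thesis
      proof (cases "\<exists>c. middle c")
        case True
        define c where "c = int (LEAST k. middle (int k))"
        obtain c' where "middle c'" using True by blast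
        then have "middle (int (nat c'))" by (simp add: middle_def)
        then have c: "middle c" unfolding c_def by (rule LeastI)
        have least: "\<not> middle d" if "d < c" for d
        proof
          assume d: "middle d"
          then have "middle (int (nat d))" by (simp add: middle_def)
          then have "(LEAST k. middle (int k)) \<le> nat d" by (rule Least_le)
          moreover have "0 < d" using d by (simp add: middle_def)
          ultimately show False using that unfolding c_def by linarith
        qed
        have c': "0 < c" "c < b" "c \<notin> R" "- c \<notin> R" "p \<le> - c" using c by (auto simp: middle_def)
        have "above_arc (- c) b (R \<inter> {- c<..<b}) x"
        proof (rule above_arcI_pivot[where k = 0])
          fix e assume e: "e \<in> insert (- c) (R \<inter> {- c<..<b})"
          consider "e = - c" | "e \<in> R" "0 < e" "e < b" | "e \<in> R" "e < 0" "- b < e"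
            using e R(7) c' by (cases e "0 :: int" rule: linorder_cases) auto
          then show "0 < inv x e"
            by cases (use low'[of c] high' opp c' neg in auto)
        next
          fix d assume d: "d \<notin> R \<or> d = b" "- c < d" "d \<le> b"
          consider "0 < d" | "d = 0" | "d < 0" by linarith
          then show "inv x d \<le> 0"
          proof cases
            case 3
            then have "- d \<in> R" using least[of "- d"] d c' negb by (auto simp: middle_def)
            then show ?thesis using high'[of "- d"] 3 d c' by (simp add: neg)
          qed (use low'[of d] d zero(1) in auto)
        qed
        moreover have "signed_arc n (- c) b (R \<inter> {- c<..<b})"
          using c' b by (intro signed_arc_restrict[OF arc]) auto
        ultimately show ?thesis using that[of "- c" b] c' ab b False by (simp add: signed_subarc_def)
      next
        case no: False
        \<comment> \<open>Otherwise \<open>- p\<close> would be a middle point. Without middle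
          points the endpoint 0 is replaced by \<open>- b\<close>, giving an arc through the
          origin.\<close>
        have pb: "p \<le> - b"
        proof (rule ccontr)
          assume "\<not> p \<le> - b"
          then have "p < 0 \<Longrightarrow> middle (- p)" using R(6,8) by (auto simp: middle_def)
          then show False using no ab(1) True R(2) by auto
        qed
        have cover: "c \<in> R \<or> - c \<in> R" if "0 < c" "c < b" for c
          using no pb that by (auto simp: middle_def)
        have "above_arc (- b) b (R \<inter> {- b<..<b}) x"
        proof (rule above_arcI_pivot[where k = 0])
          fix e assume e: "e \<in> insert (- b) (R \<inter> {- b<..<b})"
          consider "e = - b" | "e \<in> R" "0 < e" "e < b" | "e \<in> R" "e < 0" "- b < e"
            using e R(7) by (cases e "0 :: int" rule: linorder_cases) auto
          then show "0 < inv x e"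
            by cases (use negb high' opp neg in auto)
        next
          fix d assume d: "d \<notin> R \<or> d = b" "- b < d" "d \<le> b"
          consider "0 < d" | "d = 0" | "d < 0" by linarith
          then show "inv x d \<le> 0"
          proof cases
            case 3
            then have "- d \<in> R" using cover[of "- d"] d negb by auto
            then show ?thesis using high'[of "- d"] 3 d by (simp add: neg)
          qed (use low'[of d] d zero(1) in auto)
        qed
        moreover have "signed_arc n (- b) b (R \<inter> {- b<..<b})"
          using pb b negb cover by (intro signed_arc_through_origin[OF arc]) auto
        ultimately show ?thesis using that[of "- b" b] pb ab b False by (simp add: signed_subarc_def)
      qed
    next
      case nz: False
      \<comment> \<open>Otherwise \<open>(0, b)\<close> would be a shorter bad pair. So for a pair
        across the axis \<open>a\<close> stands at a positive position, which excludes
        \<open>a = - b\<close> and also a point \<open>- a\<close> of \<open>R\<close> below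
        \<open>b\<close>.\<close>
      have cross: "0 \<le> inv x b" if "a < 0" "0 < b"
      proof (rule ccontr)
        assume "\<not> 0 \<le> inv x b"
        then have "bad 0 b" using that ab R(7) zero(1) by (auto simp: bad_def)
        then show False using min[of 0 b] that by simp
      qed
      have "b \<noteq> 0" using ab(4) R(3,7) by auto
      moreover have "b \<le> - a" if "- a \<in> R" "a < - a"
      proof (rule ccontr)
        assume "\<not> b \<le> - a"
        then show False using high[of "- a"] that cross ab(5) neg[of a] by auto
      qed
      moreover have "a \<noteq> - b"
      proof
        assume "a = - b"
        then show False using cross ab(3,5) neg[of b] by auto
      qed
      ultimately have "signed_arc n a b (R \<inter> {a<..<b})"
        using ab b nz by (intro signed_arc_restrict[OF arc]) auto
      then show ?thesis using that[of a b] ab b above False by (simp add: signed_subarc_def)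
    qed
  next
    case orb: True
    define good where "good a b \<longleftrightarrow> bad a b \<and> a \<noteq> 0 \<and> b \<noteq> 0 \<and> (0 < a \<or> b < 0 \<or> a = - b)" for a b
    have q: "0 < q" using R(1) orb by auto
    have flip: "- c \<in> insert q R" if "c \<notin> R" "p \<le> c" "c < q" "c \<noteq> 0" for c
      using R(11)[OF orb, of c] R(11)[OF orb, of "- c"] that orb by (cases "0 < c"; cases "c = p") auto
    have flip': "- c \<notin> R" "p \<le> - c" if "c \<in> insert q R" for c
      using that R(6,9,10) orb by auto
    \<comment> \<open>A bad pair with 0 or across the axis is replaced by a symmetric one. In the
      latter case its upper member stands at a negative position or its lower one at a positive
      position, and that member is paired with its own negative.\<close>
    have "\<exists>a b. good a b"
    proof -
      note bad = bad0[unfolded bad_def]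
      have b0: "b\<^sub>0 \<noteq> 0" using bad R(3,7) by auto
      have qb: "b\<^sub>0 \<le> q" using bad upper by blast
      consider "a\<^sub>0 = 0" | "a\<^sub>0 \<noteq> 0" "0 < a\<^sub>0 \<or> b\<^sub>0 < 0" | "a\<^sub>0 < 0" "0 < b\<^sub>0" using b0 by linarith
      then show ?thesis
      proof cases
        case 1
        then have "good (- b\<^sub>0) b\<^sub>0" using bad flip'[of b\<^sub>0] zero neg by (auto simp: good_def bad_def)
        then show ?thesis by blast
      next
        case 2
        then show ?thesis using bad0 b0 by (auto simp: good_def)
      next
        case 3
        have "good (- b\<^sub>0) b\<^sub>0" if "inv x b\<^sub>0 < 0"
          using 3 that bad flip'[of b\<^sub>0] neg by (auto simp: good_def bad_def)
        moreover have "good a\<^sub>0 (- a\<^sub>0)" if "0 < inv x a\<^sub>0"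
          using 3 that bad flip[of a\<^sub>0] neg q by (auto simp: good_def bad_def)
        ultimately show ?thesis using bad 3 zero(2)[of b\<^sub>0] by fastforce
      qed
    qed
    then obtain a\<^sub>1 b\<^sub>1 where "good a\<^sub>1 b\<^sub>1" by blast
    then obtain a b where good: "good a b" and min: "\<And>c d. good c d \<Longrightarrow> b - a \<le> d - c"
      by (rule minimal_pair) (simp_all add: good_def bad_def)
    have ab: "p \<le> a" "a \<notin> R" "a < b" "b \<in> insert q R" "inv x b < inv x a" "a \<noteq> 0" "b \<noteq> 0"
      using good by (auto simp: good_def bad_def)
    note b = upper[OF ab(4)]
    show ?thesis
    proof (cases "a = - b")
      case False
      then have same: "0 < a \<or> b < 0" using good by (simp add: good_def)
      have "above_arc a b (R \<inter> {a<..<b}) x"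
      proof (rule above_arcI_pivot[where k = "inv x b"])
        fix e assume e: "e \<in> insert a (R \<inter> {a<..<b})"
        show "inv x b < inv x e"
        proof (rule ccontr)
          assume n: "\<not> inv x b < inv x e"
          then have "e \<in> R" "a < e" "e < b" using e ab(5) by auto
          moreover have "e \<noteq> 0" using \<open>e \<in> R\<close> R(7) by blast
          ultimately have "good a e" using ab same n by (auto simp: good_def bad_def)
          then show False using min[of a e] \<open>e < b\<close> by simp
        qed
      next
        fix d assume d: "d \<notin> R \<or> d = b" "a < d" "d \<le> b"
        show "inv x d \<le> inv x b"
        proof (rule ccontr)
          assume n: "\<not> inv x d \<le> inv x b"
          then have "d < b" "d \<notin> R" using d by (cases "d = b"; simp)+
          then have "good d b" using ab same n d by (auto simp: good_def bad_def)
          then show False using min[of d b] d(2) by simp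
        qed
      qed
      moreover have "signed_arc n a b (R \<inter> {a<..<b})"
        using ab b same by (intro signed_arc_restrict[OF arc]) auto
      ultimately show ?thesis using that[of a b] ab b same by (auto simp: signed_subarc_def)
    next
      case True
      then have b0: "0 < b" "inv x b < 0" using ab neg by auto
      have pos: "inv x d < 0" if "d \<notin> R \<or> d = b" "0 < d" "d \<le> b" for d
      proof (rule ccontr)
        assume n: "\<not> inv x d < 0"
        then have "d < b" "d \<notin> R" using that b0 by (cases "d = b"; simp)+
        then have "good d b" using ab that n b0 orb q by (auto simp: good_def bad_def)
        then show False using min[of d b] that(2) True b0 by simp
      qed
      \<comment> \<open>Exactly one of \<open>c\<close> and \<open>- c\<close> is right of the arc,
        so a left point at a positive position would give the shorter good pair
        \<open>(c, - c)\<close>.\<close>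
      have sym: "inv x c \<le> 0" if "c \<notin> R" "c < 0" "- b < c" for c
      proof (rule ccontr)
        assume n: "\<not> inv x c \<le> 0"
        have "p \<le> c" "c < q" using that b(1) orb q by linarith+
        then have "good c (- c)" using that n flip[of c] neg[of c] by (auto simp: good_def bad_def)
        then show False using min[of c "- c"] that True by simp
      qed
      have "above_arc a b (R \<inter> {a<..<b}) x"
      proof (rule above_arcI_pivot[where k = 0])
        fix e assume e: "e \<in> insert a (R \<inter> {a<..<b})"
        consider "e = - b" | "e \<in> R" "0 < e" "e < b" | "e \<in> R" "e < 0" "- b < e"
          using e R(7) True by (cases e "0 :: int" rule: linorder_cases) auto
        then show "0 < inv x e"
        proof cases
          case 1 then show ?thesis using b0 neg by simp
        next
          case 2
          then show ?thesis using sym[of "- e"] R(10)[of e] zero(2)[of e] neg[of e] by simp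
        next
          case 3
          then show ?thesis using pos[of "- e"] R(10)[of e] neg[of e] by simp
        qed
      next
        fix d assume d: "d \<notin> R \<or> d = b" "a < d" "d \<le> b"
        consider "0 < d" | "d = 0" | "d < 0" by linarith
        then show "inv x d \<le> 0"
          by cases (use pos[of d] sym[of d] zero(1) d True b0 in auto)
      qed
      moreover have "signed_arc n (- b) b (R \<inter> {- b<..<b})"
        using ab b True b0 R(11)[OF orb] by (intro signed_arc_through_origin[OF arc]) auto
      ultimately show ?thesis using that[of a b] ab b True by (simp add: signed_subarc_def)
    qed
  qed
qed

lemma exists_subarc_below:
  assumes arc: "signed_arc n p q R" and x: "x \<in> signed_perms n" and na: "\<not> above_arc p q R x"
  obtains r s where "signed_subarc n r s p q R" "r \<in> insert p R" "s \<notin> R"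
    "below_arc r s (R \<inter> {r<..<s}) x"
proof -
  have "\<not> below_arc (- q) (- p) (uminus ` R) (negate n x)"
    using na above_arc_iff_below_negate[OF arc x] by simp
  from exists_subarc_above[OF signed_arc_uminus[OF arc] negate_mem[OF x] this]
  obtain r s where sub: "signed_subarc n r s (- q) (- p) (uminus ` R)"
    and rs: "r \<notin> uminus ` R" "s \<in> insert (- p) (uminus ` R)"
    and above: "above_arc r s (uminus ` R \<inter> {r<..<s}) (negate n x)" by blast
  have sub': "signed_subarc n (- s) (- r) p q R"
    using sub signed_subarc_uminus[of n "- r" "- s" q p R] by simp
  then have "signed_arc n (- s) (- r) (R \<inter> {- s<..<- r})" by (simp add: signed_subarc_def)
  from below_arc_iff_above_negate[OF this x]
  have "below_arc (- s) (- r) (R \<inter> {- s<..<- r}) x"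
    using above by (simp add: uminus_image_Int_interval)
  then show ?thesis using that[OF sub'] rs by (auto simp: mem_uminus_image)
qed

lemma signed_subarc_refl: "signed_arc n p q R \<Longrightarrow> signed_subarc n p q p q R"
  using signed_arcD(6)[of n p q R] by (simp add: signed_subarc_def Int_absorb2)

lemma signed_subarc_le:
  "signed_subarc n p' q' p q R \<Longrightarrow> p \<le> p' \<and> p' < q' \<and> q' \<le> q"
  by (simp add: signed_subarc_def signed_arc_def)

lemma signed_subarc_trans:
  assumes "signed_subarc n p'' q'' p' q' (R \<inter> {p'<..<q'})" "signed_subarc n p' q' p q R"
  shows "signed_subarc n p'' q'' p q R"
  using assms by (auto simp: signed_subarc_def restrict_interval)

definition arc_congruence :: "nat \<Rightarrow> int \<Rightarrow> int \<Rightarrow> int set \<Rightarrow> ((int \<Rightarrow> int) \<times> (int \<Rightarrow> int)) set" where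
  "arc_congruence n p q R = {(x, y). x \<in> signed_perms n \<and> y \<in> signed_perms n \<and>
     (\<forall>p' q'. signed_subarc n p' q' p q R \<longrightarrow>
       above_arc p' q' (R \<inter> {p'<..<q'}) x = above_arc p' q' (R \<inter> {p'<..<q'}) y)}"

lemma not_above_and_below:
  assumes "above_arc r s (R \<inter> {r<..<s}) x" "below_arc p q R x"
    and "p \<le> r" "r < s" "s \<le> q" "r \<notin> R" "s \<in> insert q R"
  shows False
  using assms by (auto simp: above_arc_def below_arc_def)

lemma not_above_and_below':
  assumes "above_arc p q R x" "below_arc r s (R \<inter> {r<..<s}) x"
    and "p \<le> r" "r < s" "s \<le> q" "r \<in> insert p R" "s \<notin> R"
  shows False
  using assms by (auto simp: above_arc_def below_arc_def)

text \<open>The sets of subarcs above and below which an element lies determine each other, so the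
  relation is compatible with meets by its definition and with joins by its dual description.\<close>

lemma arc_congruence_iff_below:
  assumes arc: "signed_arc n p q R"
  shows "(x, y) \<in> arc_congruence n p q R \<longleftrightarrow> x \<in> signed_perms n \<and> y \<in> signed_perms n \<and>
     (\<forall>p' q'. signed_subarc n p' q' p q R \<longrightarrow>
       below_arc p' q' (R \<inter> {p'<..<q'}) x = below_arc p' q' (R \<inter> {p'<..<q'}) y)"
    (is "?l \<longleftrightarrow> ?r")
proof -
  have below: "below_arc p' q' (R \<inter> {p'<..<q'}) x"
    if sub: "signed_subarc n p' q' p q R" and mem: "x \<in> signed_perms n"
      and same: "\<And>p' q'. signed_subarc n p' q' p q R \<Longrightarrow>
        above_arc p' q' (R \<inter> {p'<..<q'}) x = above_arc p' q' (R \<inter> {p'<..<q'}) y"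
      and y: "below_arc p' q' (R \<inter> {p'<..<q'}) y" for p' q' x y
  proof (rule ccontr)
    have arc': "signed_arc n p' q' (R \<inter> {p'<..<q'})" using sub by (simp add: signed_subarc_def)
    assume "\<not> below_arc p' q' (R \<inter> {p'<..<q'}) x"
    from exists_subarc_above[OF arc' mem this] obtain r s where
      rs: "signed_subarc n r s p' q' (R \<inter> {p'<..<q'})" "r \<notin> R \<inter> {p'<..<q'}" "s \<in> insert q' (R \<inter> {p'<..<q'})"
      "above_arc r s (R \<inter> {p'<..<q'} \<inter> {r<..<s}) x" by blast
    note le = signed_subarc_le[OF rs(1)]
    have "above_arc r s (R \<inter> {p'<..<q'} \<inter> {r<..<s}) y"
      using same[OF signed_subarc_trans[OF rs(1) sub]] rs(4) le by (simp add: restrict_interval)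
    then show False using not_above_and_below[OF _ y] le rs by blast
  qed
  have above: "above_arc p' q' (R \<inter> {p'<..<q'}) x"
    if sub: "signed_subarc n p' q' p q R" and mem: "x \<in> signed_perms n"
      and same: "\<And>p' q'. signed_subarc n p' q' p q R \<Longrightarrow>
        below_arc p' q' (R \<inter> {p'<..<q'}) x = below_arc p' q' (R \<inter> {p'<..<q'}) y"
      and y: "above_arc p' q' (R \<inter> {p'<..<q'}) y" for p' q' x y
  proof (rule ccontr)
    have arc': "signed_arc n p' q' (R \<inter> {p'<..<q'})" using sub by (simp add: signed_subarc_def)
    assume "\<not> above_arc p' q' (R \<inter> {p'<..<q'}) x"
    from exists_subarc_below[OF arc' mem this] obtain r s where
      rs: "signed_subarc n r s p' q' (R \<inter> {p'<..<q'})" "r \<in> insert p' (R \<inter> {p'<..<q'})" "s \<notin> R \<inter> {p'<..<q'}"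
      "below_arc r s (R \<inter> {p'<..<q'} \<inter> {r<..<s}) x" by blast
    note le = signed_subarc_le[OF rs(1)]
    have "below_arc r s (R \<inter> {p'<..<q'} \<inter> {r<..<s}) y"
      using same[OF signed_subarc_trans[OF rs(1) sub]] rs(4) le by (simp add: restrict_interval)
    then show False using not_above_and_below'[OF y] le rs by blast
  qed
  show ?thesis
  proof
    assume l: ?l
    then have mem: "x \<in> signed_perms n" "y \<in> signed_perms n"
      and same: "\<And>p' q'. signed_subarc n p' q' p q R \<Longrightarrow>
        above_arc p' q' (R \<inter> {p'<..<q'}) x = above_arc p' q' (R \<inter> {p'<..<q'}) y"
      by (auto simp: arc_congruence_def)
    show ?r using mem below[OF _ mem(1) same] below[OF _ mem(2) same[symmetric]] by blast
  next
    assume ?r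
    then have mem: "x \<in> signed_perms n" "y \<in> signed_perms n"
      and same: "\<And>p' q'. signed_subarc n p' q' p q R \<Longrightarrow>
        below_arc p' q' (R \<inter> {p'<..<q'}) x = below_arc p' q' (R \<inter> {p'<..<q'}) y"
      by auto
    show ?l unfolding arc_congruence_def
      using mem above[OF _ mem(1) same] above[OF _ mem(2) same[symmetric]] by blast
  qed
qed

lemma lattice_congruence_arc_congruence:
  assumes arc: "signed_arc n p q R"
  shows "lattice_congruence (weak_order n) (arc_congruence n p q R)"
  unfolding weak_congruence_iff
proof (intro conjI allI impI)
  show "equiv (signed_perms n) (arc_congruence n p q R)"
    by (rule equivI) (auto simp: arc_congruence_def refl_on_def sym_def trans_def)
next
  fix x x' y y' assume xy: "(x, x') \<in> arc_congruence n p q R" "(y, y') \<in> arc_congruence n p q R"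
  then have mem: "x \<in> signed_perms n" "x' \<in> signed_perms n" "y \<in> signed_perms n" "y' \<in> signed_perms n"
    by (auto simp: arc_congruence_def)
  show "(weak_inf n x y, weak_inf n x' y') \<in> arc_congruence n p q R"
    using xy mem unfolding arc_congruence_def
    by (auto simp: weak_inf_mem above_arc_weak_inf signed_subarc_def)
  show "(weak_sup n x y, weak_sup n x' y') \<in> arc_congruence n p q R"
    using xy mem unfolding arc_congruence_iff_below[OF arc]
    by (auto simp: weak_sup_mem below_arc_weak_sup signed_subarc_def)
qed

subsection \<open>Join-irreducible elements and type-B arcs\<close>

text \<open>The image under \<open>phi\<close> of the arc, written without a permutation. For
  \<open>q < 0\<close> the half turn exchanges the sides, hence the complement; for an arc through
  the origin the positive part of \<open>R\<close> determines the negative one.\<close>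

definition arc_typeB :: "int \<Rightarrow> int \<Rightarrow> int set \<Rightarrow> typeB_arc" where
  "arc_typeB p q R =
    (if 0 < p then Ordinary p q R
     else if q < 0 then Ordinary (- q) (- p) (uminus ` ({p<..<q} - R))
     else if p = - q then Orbifold q (R \<inter> {0<..})
     else Long (- p) q (uminus ` (R \<inter> {..<0})) (R \<inter> {0<..}))"

lemma descent_arc_eq:
  assumes j: "j \<in> signed_perms n" and b: "next_pos a = inv j p" and a: "a = inv j q"
  shows "descent_arc j a = Sym_Arc q p {c \<in> {p<..<q}. inv j c < inv j q} {c \<in> {p<..<q}. inv j p < inv j c}"
proof -
  have "{j c |c. P c \<and> p < j c \<and> j c < q} = {c \<in> {p<..<q}. P (inv j c)}" for P
    using j by (auto intro!: exI[of _ "inv j _"])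
  from this[of "\<lambda>c. c < a"] this[of "\<lambda>c. inv j p < c"]
  show ?thesis unfolding descent_arc_def b Let_def using j by (simp add: a)
qed

text \<open>In \<open>j\<close> the values \<open>q\<close> and \<open>p\<close> are neighbours up
  to the central 0, with the points of \<open>R\<close> after them and the nonzero left points
  before them, so the descent between them draws the given arc.\<close>

lemma arc_typeB_mem_delta_orb:
  assumes arc: "signed_arc n p q R" and j: "j \<in> signed_perms n"
    and inv: "inversions j = arc_inversions p q R"
  shows "arc_typeB p q R \<in> delta_orb n j"
proof -
  note R = signed_arcD[OF arc]
  define a b where "a = inv j q" and "b = inv j p"
  have neg: "inv j (- c) = - inv j c" for c using j by (rule signed_perms_inv_uminus)
  have ne: "inv j c = inv j d \<longleftrightarrow> c = d" for c d using j by (rule signed_perms_inv_eq_iff)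
  have "(p, q) \<in> inversions j" using R by (auto simp: inv arc_inversions_def)
  then have ab: "a < b" by (simp add: mem_inversions a_def b_def)
  have nz: "a \<noteq> 0" "b \<noteq> 0" using R j by (auto simp: a_def b_def signed_perms_inv_eq_zero_iff)
  have right: "b < inv j c" if "c \<in> R" for c
  proof -
    have c: "p < c" "c < q" "- c \<notin> R" "- c \<noteq> p" using R that by auto
    then have "(p, c) \<notin> inversions j" using that R(8) by (auto simp: inv arc_inversions_def)
    then show ?thesis using c ne[of p c] by (auto simp: mem_inversions b_def)
  qed
  have left: "inv j c < a" if "c \<notin> R" "p < c" "c < q" "c = 0 \<longrightarrow> p \<noteq> - q" for c
  proof -
    have "- c \<in> R" if "p = - q"
      using R(11)[OF that, of c] R(11)[OF that, of "- c"] \<open>c \<notin> R\<close> \<open>p < c\<close> \<open>c < q\<close> \<open>c = 0 \<longrightarrow> p \<noteq> - q\<close> that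
      by (cases "0 < c") auto
    then have "(c, q) \<notin> inversions j" using that R(9) by (auto simp: inv arc_inversions_def)
    then show ?thesis using that ne[of c q] by (auto simp: mem_inversions a_def)
  qed
  have zero: "inv j 0 = 0" using j by simp
  have adjacent: "inv j c \<le> a \<or> b \<le> inv j c" if c0: "c \<noteq> 0" for c
  proof -
    consider "c = p" | "c = q" | "p < c" "c < q" | "q < c" | "c < p" by linarith
    then show ?thesis
    proof cases
      case 3
      then show ?thesis using left[of c] right[of c] c0 by (cases "c \<in> R") auto
    next
      case 4
      have "(q, c) \<in> inversions j" if "(p, c) \<in> inversions j"
        using that R(1,2,3,6,9) 4 by (auto simp: inv arc_inversions_def)
      then show ?thesis using 4 R(1) ne[of q c] ne[of p c]
        by (auto simp: mem_inversions a_def b_def)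
    next
      case 5
      have "(c, q) \<notin> inversions j"
        using R(1,2,3,6,8,9) 5 by (auto simp: inv arc_inversions_def)
      then show ?thesis using 5 R(1) ne[of q c] ne[of p c]
        by (auto simp: mem_inversions a_def b_def)
    qed (auto simp: a_def b_def)
  qed
  have next_pos: "next_pos a = b"
  proof (rule ccontr)
    assume "next_pos a \<noteq> b"
    then have k: "a < next_pos a" "next_pos a < b" "next_pos a \<noteq> 0"
      using ab nz by (auto simp: next_pos_def split: if_splits)
    have "j (next_pos a) \<noteq> 0" using k(3) j by (metis signed_perms_inv_apply signed_perms_inv_zero)
    from adjacent[OF this] show False using k j by simp
  qed
  have "{c \<in> {p<..<q}. b < inv j c} = R"
  proof -
    have "\<not> b < inv j 0" if "p = - q" using ab zero neg[of q] that by (simp add: a_def b_def)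
    then have "c \<in> R" if "p < c" "c < q" "b < inv j c" for c
      using that left[of c] ab by (cases "c = 0 \<and> p = - q") force+
    then show ?thesis using right R(6) by auto
  qed
  \<comment> \<open>If \<open>p = - q\<close>, the value 0 stands between the two positions and
    belongs to neither side, which is how an arc through the origin is recognized.\<close>
  moreover have "{c \<in> {p<..<q}. inv j c < a} = {p<..<q} - R - (if p = - q then {0} else {})"
  proof -
    have "\<not> inv j 0 < a" if "p = - q" using ab zero neg[of q] that by (simp add: a_def b_def)
    moreover have "\<not> inv j c < a" if "c \<in> R" for c using right[OF that] ab by simp
    ultimately show ?thesis using left by (auto split: if_splits)
  qed
  ultimately have d: "descent_arc j a = Sym_Arc q p ({p<..<q} - R - (if p = - q then {0} else {})) R"
    using descent_arc_eq[OF j, of a p q] next_pos by (simp add: a_def b_def)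
  have phi: "phi (descent_arc j a) = arc_typeB p q R"
  proof -
    consider "0 < p" | "p < 0" "q < 0" | "p < 0" "0 < q" using R by linarith
    then show ?thesis
      by cases (use R(1,7) in \<open>auto simp: d phi_def arc_typeB_def\<close>)
  qed
  have "\<bar>a\<bar> \<le> int n" "\<bar>b\<bar> \<le> int n"
    using R(1,4,5) unfolding a_def b_def by (intro signed_perms_inv_inside[OF j]; simp)+
  moreover have "j a > j (next_pos a)" using next_pos j R(1) by (simp add: a_def b_def)
  ultimately have "descent_arc j a \<in> delta n j"
    using nz ab unfolding delta_def by (intro imageI) auto
  then show ?thesis using phi unfolding delta_orb_def by (metis imageI)
qed

section \<open>Join-irreducible elements as signed permutations with one descent\<close>

lemma join_irreducible_descent:
  assumes "join_irreducible n j"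
  obtains i where "0 \<le> i" "i < int n" "j (i + 1) < j i"
    "\<And>k. 0 \<le> k \<Longrightarrow> k < int n \<Longrightarrow> k \<noteq> i \<Longrightarrow> j k < j (k + 1)"
proof -
  have j: "j \<in> signed_perms n" and ex1: "\<exists>!\<pi>. weak_covered n \<pi> j"
    using assms by (auto simp: join_irreducible_def)
  obtain \<pi> i where i: "\<pi> \<in> signed_perms n" "0 \<le> i" "i < int n" "\<pi> i < \<pi> (i + 1)" "j = \<pi> \<circ> adj_swap i"
    using ex1 by (auto simp: weak_covered_iff)
  have desc: "j (i + 1) < j i" using i by (auto simp: adj_swap_apply signed_perms_uminus)
  have cover: "weak_covered n (j \<circ> adj_swap k) j" if "0 \<le> k" "k < int n" "j (k + 1) < j k" for k
  proof -
    have "j = j \<circ> adj_swap k \<circ> adj_swap k" using that by (auto simp: adj_swap_involutive)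
    moreover have "(j \<circ> adj_swap k) k < (j \<circ> adj_swap k) (k + 1)"
      using that j by (auto simp: adj_swap_apply signed_perms_uminus)
    moreover have "j \<circ> adj_swap k \<in> signed_perms n"
      using that j by (intro signed_perms_comp adj_swap_mem)
    ultimately show ?thesis using that by (auto simp: weak_covered_iff)
  qed
  have "j k < j (k + 1)" if k: "0 \<le> k" "k < int n" "k \<noteq> i" for k
  proof (rule ccontr)
    assume "\<not> j k < j (k + 1)"
    moreover have "j k \<noteq> j (k + 1)" using j by (simp add: signed_perms_eq_iff)
    ultimately have "j \<circ> adj_swap k = j \<circ> adj_swap i"
      using ex1 cover[of k] cover[of i] desc i k by force
    \<comment> \<open>Undoing any descent gives a lower cover, and different swaps give different
      ones.\<close>
    then have "adj_swap k (k + 1) = adj_swap i (k + 1)" "adj_swap k (i + 1) = adj_swap i (i + 1)"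
      using j by (metis comp_apply signed_perms_eq_iff)+
    then show False using k i(2) by (auto simp: adj_swap_apply split: if_splits)
  qed
  then show ?thesis using that i(2,3) desc by blast
qed

text \<open>A half turn exchanges the endpoints and the two sides. A long arc thus arises in two
  ways, with the origin on the left or on the right, and the two branches of \<open>phi\<close>
  agree on them.\<close>

lemma phi_mirror:
  assumes "l < u" "l \<noteq> 0" "u \<noteq> 0" "l < 0 \<Longrightarrow> 0 < u \<Longrightarrow> 0 \<in> L" "0 \<notin> R"
  shows "phi (Sym_Arc (- l) (- u) (uminus ` R) (uminus ` L)) = phi (Sym_Arc u l L R)"
proof -
  have neg: "uminus ` (uminus ` A \<inter> {..<0}) = A \<inter> {0<..}" "uminus ` (A \<inter> {..<0}) = uminus ` A \<inter> {0<..}"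
    for A :: "int set" by force+
  have "0 \<in> uminus ` L \<longleftrightarrow> 0 \<in> L" "0 \<notin> uminus ` R" using assms by force+
  then show ?thesis using assms by (auto simp: phi_def neg image_image)
qed

text \<open>As \<open>j\<close> increases on 0..i and from i + 1 on, entries at nonnegative
  positions are inverted only across the descent. For \<open>i = 0\<close> the neighbour of
  \<open>j 1\<close> in the long notation is \<open>- j 1\<close>, not the 0 at position 0, whence
  the form of \<open>q\<close>. Taking the descent at a nonnegative position is what makes
  \<open>q\<close> positive.\<close>

lemma inversions_one_descent:
  assumes j: "j \<in> signed_perms n" and i: "0 \<le> i" "i < int n" "j (i + 1) < j i"
    and asc: "\<And>k. 0 \<le> k \<Longrightarrow> k < int n \<Longrightarrow> k \<noteq> i \<Longrightarrow> j k < j (k + 1)"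
    and q: "q = (if i = 0 then - j 1 else j i)" and p: "p = j (i + 1)"
    and R: "R = {c \<in> {p<..<q}. i + 1 < inv j c}"
  shows "signed_arc n p q R" "0 < q" "inversions j = arc_inversions p q R"
proof -
  have neg: "inv j (- c) = - inv j c" for c using j by (rule signed_perms_inv_uminus)
  have zero: "j 0 = 0" using j by simp
  have below: "j k < j l" if "0 \<le> k" "k < l" "l \<le> i" for k l
    using that(2,3,1)
  proof (induction l rule: int_gr_induct)
    case base then show ?case using asc[of k] i by simp
  next
    case (step l) then show ?case using asc[of l] i by simp
  qed
  \<comment> \<open>This continues past n, where \<open>j\<close> is the identity.\<close>
  have above: "j k < j l" if "i < k" "k < l" for k l
    using that(2,1)
  proof (induction l rule: int_gr_induct)
    case base
    then show ?case using asc[of k] i signed_perms_inside[OF j, of k] signed_perms_outside[OF j]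
      by (cases "k < int n"; cases "k = int n") auto
  next
    case (step l)
    have "j l < j (l + 1)"
      using asc[of l] i step signed_perms_inside[OF j, of l] signed_perms_outside[OF j]
      by (cases "l < int n"; cases "l = int n") auto
    then show ?case using step by simp
  qed
  have pos: "0 < j k" if "0 < k" "k \<le> i" for k using below[of 0 k] that zero by simp
  show q0: "0 < q" using pos[of i] i zero by (auto simp: q)
  have inv_p: "inv j p = i + 1" using j by (simp add: p)
  have inv_q: "inv j q = (if i = 0 then - 1 else i)" using j neg[of "j 1"] by (simp add: q)
  have small: "c \<le> q \<and> 0 \<le> c" if "0 \<le> inv j c" "inv j c \<le> i" for c
  proof -
    have "j (inv j c) \<le> q \<and> 0 \<le> j (inv j c)"
    proof (cases "inv j c = 0")
      case True then show ?thesis using q0 zero by simp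
    next
      case False
      then show ?thesis using that pos[of "inv j c"] below[of "inv j c" i] i by (cases "inv j c = i") (auto simp: q)
    qed
    then show ?thesis using j by simp
  qed
  define A where "A = insert p R"
  have pq: "p < q" using i q0 zero by (auto simp: p q split: if_splits)
  have large: "p < c" if "i + 1 < inv j c" for c using above[of "i + 1" "inv j c"] that j by (simp add: p)
  have A: "c \<in> A \<longleftrightarrow> i + 1 \<le> inv j c \<and> c < q" for c
  proof
    assume "i + 1 \<le> inv j c \<and> c < q"
    then show "c \<in> A" using large[of c] inv_p signed_perms_inv_eq_iff[OF j, of p c]
      by (cases "inv j c = i + 1") (auto simp: A_def R)
  qed (use pq inv_p in \<open>auto simp: A_def R\<close>)
  show "signed_arc n p q R"
    unfolding signed_arc_def
  proof (intro conjI impI ballI)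
    show "p < q" by (rule pq)
    show "p \<noteq> 0" using inv_p i j by auto
    show "q \<noteq> 0" using q0 by simp
    show "- int n \<le> p" using signed_perms_inside[OF j, of "i + 1"] i by (simp add: p)
    show "q \<le> int n" using signed_perms_inside[OF j, of i] signed_perms_inside[OF j, of 1] i
      by (auto simp: q)
    show "R \<subseteq> {p<..<q}" by (auto simp: R)
    show "0 \<notin> R" using j i by (simp add: R)
    show "- p \<notin> R" using neg[of p] inv_p i by (simp add: R)
    show "- q \<notin> R" using neg[of q] inv_q i by (auto simp: R)
    fix c
    show "c \<in> R \<Longrightarrow> - c \<notin> R" using neg[of c] i by (auto simp: R)
    assume eq: "p = - q" and c: "c \<in> {0<..<q}"
    have i0: "i = 0" using eq neg[of q] inv_p inv_q i by (auto split: if_splits)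
    have "inv j c \<noteq> 0" "inv j c \<noteq> - 1" "inv j c \<noteq> 1"
      using c eq q0 inv_q inv_p i0 signed_perms_inv_eq_zero_iff[OF j, of c]
        signed_perms_inv_eq_iff[OF j, of c q] signed_perms_inv_eq_iff[OF j, of c p] by auto
    then have "1 < inv j c \<or> 1 < inv j (- c)" using neg[of c] by auto
    then show "c \<in> R \<or> - c \<in> R" using c eq i0 by (auto simp: R)
  qed
  have ord: "c < d" if "0 \<le> inv j c" "inv j c < inv j d" "inv j d \<le> i \<or> i < inv j c" for c d
    using that below[of "inv j c" "inv j d"] above[of "inv j c" "inv j d"] j by auto
  have "(a, b) \<in> inversions j \<longleftrightarrow> a < b \<and> (a \<in> A \<and> b \<notin> A \<and> b \<le> q \<or>
      - b \<in> A \<and> - a \<notin> A \<and> - q \<le> a \<or> a \<in> A \<and> - b \<in> A)" for a b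
  proof
    assume "(a, b) \<in> inversions j"
    then have ab: "a < b" "inv j b < inv j a" by (auto simp: mem_inversions)
    have main: "d \<le> q \<and> i < inv j c \<and> inv j d \<le> i"
      if "0 \<le> inv j d" "inv j d < inv j c" "c < d" for c d
      using that ord[of d c] small[of d] by (cases "inv j d \<le> i"; cases "inv j c \<le> i") auto
    consider "0 \<le> inv j b" | "inv j a \<le> 0" | "inv j b < 0" "0 < inv j a" by linarith
    then show "a < b \<and> (a \<in> A \<and> b \<notin> A \<and> b \<le> q \<or>
      - b \<in> A \<and> - a \<notin> A \<and> - q \<le> a \<or> a \<in> A \<and> - b \<in> A)"
    proof cases
      case 1
      then show ?thesis using main[of b a] ab by (auto simp: A)
    next
      case 2
      then show ?thesis using main[of "- a" "- b"] ab by (auto simp: A neg)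
    next
      case 3
      have a: "0 < a \<or> i < inv j a" using 3 small[of a] j by (cases "a = 0") force+
      have b: "b < 0 \<or> i < - inv j b" using 3 small[of "- b"] j neg[of b] by (cases "b = 0") force+
      show ?thesis
        using a b ab 3 i q0 small[of a] small[of "- b"]
        by (cases "i < inv j a"; cases "i < - inv j b"; cases "a < q"; cases "- b < q") (auto simp: A neg)
    qed
  next
    assume *: "a < b \<and> (a \<in> A \<and> b \<notin> A \<and> b \<le> q \<or>
      - b \<in> A \<and> - a \<notin> A \<and> - q \<le> a \<or> a \<in> A \<and> - b \<in> A)"
    have one: "inv j d < inv j c" if "c \<in> A" "d \<notin> A" "d \<le> q" for c d
      using that inv_q i by (cases "d = q") (auto simp: A split: if_splits)
    show "(a, b) \<in> inversions j"
      using * one[of a b] one[of "- b" "- a"] i by (auto simp: mem_inversions neg A)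
  qed
  then show "inversions j = arc_inversions p q R" using q0 by (auto simp: arc_inversions_def A_def)
qed

text \<open>A descent off the centre occurs twice in the long notation, at mirrored positions;
  \<open>phi\<close> identifies the two arcs.\<close>

lemma delta_orb_one_descent:
  assumes j: "j \<in> signed_perms n" and i: "0 \<le> i" "i < int n"
    and asc: "\<And>k. 0 \<le> k \<Longrightarrow> k < int n \<Longrightarrow> k \<noteq> i \<Longrightarrow> j k < j (k + 1)"
  shows "delta_orb n j \<subseteq> {phi (descent_arc j (if i = 0 then - 1 else i))}"
proof -
  have neg: "j (- c) = - j c" for c using j by (rule signed_perms_uminus)
  have zero: "j 0 = 0" using j by simp
  have "phi (descent_arc j a) = phi (descent_arc j (if i = 0 then - 1 else i))"
    if a: "- int n \<le> a" "a < int n" "a \<noteq> 0" "j (next_pos a) < j a" for a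
  proof -
    consider "a = - 1" | "0 < a" | "a < - 1" using a(3) by linarith
    then show ?thesis
    proof cases
      case 1
      then have "j 1 < 0" using a neg[of 1] by (simp add: next_pos_def)
      then have "i = 0" using asc[of 0] zero a 1 by force
      then show ?thesis using 1 by simp
    next
      case 2
      then have "i = a" using asc[of a] a by (force simp: next_pos_def)
      then show ?thesis using 2 by simp
    next
      case 3
      have "j (- a) < j (- a - 1) \<or> j (- a) = j (- a - 1)" using a 3 neg[of a] neg[of "a + 1"] by (simp add: next_pos_def)
      then have ia: "i = - a - 1" using asc[of "- a - 1"] a 3 by force
      then have i1: "0 < i" and a': "a = - (i + 1)" and nx: "next_pos a = - i" using 3 by (auto simp: next_pos_def)
      define p q where "p = j (i + 1)" and "q = j i"
      have inv: "inv j p = i + 1" "inv j q = i" "inv j (- p) = - (i + 1)" "inv j (- q) = - i"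
        using j by (simp_all add: p_def q_def signed_perms_inv_uminus)
      define L R where "L = {c \<in> {p<..<q}. inv j c < i}" and "R = {c \<in> {p<..<q}. i + 1 < inv j c}"
      have eq: "{c \<in> {- q<..<- p}. inv j c < - (i + 1)} = uminus ` R"
        "{c \<in> {- q<..<- p}. - i < inv j c} = uminus ` L"
      proof -
        have "- c \<in> A \<longleftrightarrow> c \<in> uminus ` A" for c and A :: "int set" by force
        then show "{c \<in> {- q<..<- p}. inv j c < - (i + 1)} = uminus ` R"
          "{c \<in> {- q<..<- p}. - i < inv j c} = uminus ` L"
          by (auto simp: L_def R_def signed_perms_inv_uminus[OF j] simp flip: \<open>\<And>A c. - c \<in> A \<longleftrightarrow> c \<in> uminus ` A\<close>)
      qed
      have "descent_arc j a = Sym_Arc (- p) (- q) (uminus ` R) (uminus ` L)"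
        using descent_arc_eq[OF j, of a "- q" "- p", unfolded inv eq, OF nx a'] .
      moreover have "descent_arc j i = Sym_Arc q p L R"
      proof -
        have "next_pos i = i + 1" using i1 by (simp add: next_pos_def)
        from descent_arc_eq[OF j, of i p q, unfolded inv, OF this refl] show ?thesis
          by (simp only: L_def R_def)
      qed
      moreover have "phi (Sym_Arc (- p) (- q) (uminus ` R) (uminus ` L)) = phi (Sym_Arc q p L R)"
      proof (rule phi_mirror)
        have "j (- i) < j (- (i + 1))" using a(4) unfolding nx unfolding a' .
        then show "p < q" using neg[of i] neg[of "i + 1"] unfolding p_def q_def by linarith
        show "p \<noteq> 0" "q \<noteq> 0" using inv i1 j by auto
      qed (use i1 j in \<open>simp_all add: L_def R_def\<close>)
      ultimately show ?thesis using i1 by simp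
    qed
  qed
  then show ?thesis by (auto simp: delta_orb_def delta_def)
qed

theorem join_irreducible_arc:
  assumes "join_irreducible n j"
  obtains p q R where "signed_arc n p q R" "0 < q" "inversions j = arc_inversions p q R"
proof -
  have j: "j \<in> signed_perms n" using assms by (simp add: join_irreducible_def)
  obtain i where "0 \<le> i" "i < int n" "j (i + 1) < j i"
    "\<And>k. 0 \<le> k \<Longrightarrow> k < int n \<Longrightarrow> k \<noteq> i \<Longrightarrow> j k < j (k + 1)"
    using join_irreducible_descent[OF assms] by blast
  from inversions_one_descent[OF j this refl refl refl] show ?thesis using that by blast
qed

theorem arc_of_eq_arc_typeB:
  assumes "join_irreducible n j" "signed_arc n p q R" "inversions j = arc_inversions p q R"
  shows "arc_of n j = arc_typeB p q R"
proof -
  have j: "j \<in> signed_perms n" using assms by (simp add: join_irreducible_def)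
  obtain i where i: "0 \<le> i" "i < int n" "\<And>k. 0 \<le> k \<Longrightarrow> k < int n \<Longrightarrow> k \<noteq> i \<Longrightarrow> j k < j (k + 1)"
    using join_irreducible_descent[OF assms(1)] by blast
  have "delta_orb n j = {arc_typeB p q R}"
    using arc_typeB_mem_delta_orb[OF assms(2) j assms(3)] subset_singletonD[OF delta_orb_one_descent[OF j i]]
    by auto
  then show ?thesis by (simp add: arc_of_def)
qed

section \<open>Contraction of a join-irreducible and of its arc\<close>

lemma weak_covered_lower_cover:
  "join_irreducible n j \<Longrightarrow> weak_covered n (lower_cover n j) j"
  unfolding join_irreducible_def lower_cover_def
  by (elim conjE) (rule theI'[of "\<lambda>\<pi>. weak_covered n \<pi> j"])

lemma le_lower_cover:
  assumes "join_irreducible n j" "x \<in> signed_perms n" "weak_le x j" "x \<noteq> j"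
  shows "weak_le x (lower_cover n j)"
proof -
  have j: "j \<in> signed_perms n" and ex1: "\<exists>!\<pi>. weak_covered n \<pi> j"
    using assms(1) by (auto simp: join_irreducible_def)
  have "(weak_covered n)\<^sup>*\<^sup>* x j" using assms j by (simp add: weak_le_iff weak_le_def)
  then obtain \<pi> where \<pi>: "(weak_covered n)\<^sup>*\<^sup>* x \<pi>" "weak_covered n \<pi> j"
    using assms(4) by (auto elim: rtranclp.cases)
  then have "\<pi> = lower_cover n j" using ex1 weak_covered_lower_cover[OF assms(1)] by blast
  then show ?thesis using \<pi> weak_covered_mem assms(2) by (metis weak_le_iff weak_le_def)
qed

text \<open>Meeting a separated pair with \<open>j\<close> gives \<open>u\<close> congruent to
  \<open>j\<close> and strictly below it, hence below the lower cover. Meeting once more with the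
  lower cover shows that \<open>u\<close> is congruent to it too.\<close>

lemma contracts_iff_arc_contracted:
  assumes ji: "join_irreducible n j" and arc: "signed_arc n p q R"
    and inv: "inversions j = arc_inversions p q R" and cong: "lattice_congruence (weak_order n) \<theta>"
  shows "contracts n \<theta> j \<longleftrightarrow> arc_contracted \<theta> p q R"
proof -
  define j' where "j' = lower_cover n j"
  have cover: "weak_covered n j' j" using weak_covered_lower_cover[OF ji] by (simp add: j'_def)
  then have mem: "j \<in> signed_perms n" "j' \<in> signed_perms n" and less: "inversions j' \<subset> inversions j"
    using weak_covered_mem weak_covered_inversions by blast+
  have above: "above_arc p q R x \<longleftrightarrow> weak_le j x" if "x \<in> signed_perms n" for x
    using above_arc_iff[OF arc that] inv by (simp add: weak_le_def)
  show ?thesis unfolding contracts_def j'_def[symmetric]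
  proof
    assume "(j, j') \<in> \<theta>"
    then have "(j', j) \<in> \<theta>" by (rule weak_congruence_sym[OF cong])
    moreover have "above_arc p q R j" "\<not> above_arc p q R j'"
      using above mem less by (auto simp: weak_le_def)
    ultimately show "arc_contracted \<theta> p q R" by (auto simp: arc_contracted_def)
  next
    assume "arc_contracted \<theta> p q R"
    then obtain x y where xy: "(x, y) \<in> \<theta>" "above_arc p q R y" "\<not> above_arc p q R x"
      by (auto simp: arc_contracted_def)
    note xy_mem = weak_congruence_mem[OF cong xy(1)]
    define u where "u = weak_inf n j x"
    have u: "u \<in> signed_perms n" "weak_le u j" "weak_le u x"
      using mem xy_mem le_weak_inf_iff[OF mem(1) xy_mem(1), of u] by (auto simp: u_def weak_inf_mem)
    have "weak_inf n j y = j" using above xy xy_mem mem by (simp add: weak_inf_absorb)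
    then have uj: "(u, j) \<in> \<theta>"
      using weak_congruence_inf[OF cong weak_congruence_refl[OF cong mem(1)] xy(1)] by (simp add: u_def)
    have "u \<noteq> j" using u(3) xy(3) above xy_mem by auto
    then have "weak_le u j'" using le_lower_cover[OF ji u(1,2)] by (simp add: j'_def)
    then have "weak_inf n u j' = u" using u mem by (intro weak_inf_absorb)
    moreover have "weak_inf n j j' = j'"
      using less mem weak_inf_absorb[of j' n j] weak_inf_commute[of j n j'] by (auto simp: weak_le_def)
    ultimately have "(u, j') \<in> \<theta>"
      using weak_congruence_inf[OF cong uj weak_congruence_refl[OF cong mem(2)]] by simp
    then show "(j, j') \<in> \<theta>"
      using uj cong weak_congruence_sym[OF cong uj]
      by (auto simp: weak_congruence_iff equiv_def dest: transD)
  qed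
qed

subsection \<open>Subarcs of type-B arcs\<close>

lemma is_typeB_arc_arc_typeB:
  assumes "signed_arc n p q R" shows "is_typeB_arc n (arc_typeB p q R)"
proof -
  note R = signed_arcD[OF assms]
  consider "0 < p" | "p < 0" "q < 0" | "p < 0" "0 < q" "p = - q" | "p < 0" "0 < q" "p \<noteq> - q"
    using R(2,3) by linarith
  then show ?thesis
  proof cases
    case 4
    have "uminus ` (R \<inter> {..<0}) \<inter> (R \<inter> {0<..}) = {}" using R(10) by auto
    then show ?thesis using 4 R(4-9) by (auto simp: arc_typeB_def mem_uminus_image)
  qed (use R(1,4-6) in \<open>auto simp: arc_typeB_def\<close>)
qed

lemma int_set_eqI_by_sign:
  fixes R S :: "int set"
  assumes "R \<inter> {0<..} = S \<inter> {0<..}" "R \<inter> {..<0} = S \<inter> {..<0}" "0 \<notin> R" "0 \<notin> S"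
  shows "R = S"
proof (rule Set.set_eqI)
  fix c :: int
  consider "0 < c" | "c < 0" | "c = 0" by linarith
  then show "c \<in> R \<longleftrightarrow> c \<in> S" by cases (use assms in blast)+
qed

text \<open>The second alternative is an ordinary arc along the left piece of a long arc. In the
  signed picture that piece lies below the axis, so it is the mirror image of the ordinary arc that
  is the subarc.\<close>

lemma signed_subarc_if_subarc:
  assumes arc': "signed_arc n p' q' R'" "0 < q'" and arc: "signed_arc n p q R" "0 < q"
    and sub: "subarc n (arc_typeB p' q' R') (arc_typeB p q R)"
  shows "signed_subarc n p' q' p q R \<and> R' = R \<inter> {p'<..<q'} \<or>
    0 < p' \<and> signed_subarc n (- q') (- p') p q R \<and>
      R \<inter> {- q'<..<- p'} = uminus ` ({p'<..<q'} - R')"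
proof -
  note R = signed_arcD[OF arc(1)] and R' = signed_arcD[OF arc'(1)]
  have cond: "subarc_cond (arc_typeB p' q' R') (arc_typeB p q R)" using sub by (simp add: subarc_def)
  have goal1: ?thesis if "p \<le> p'" "q' \<le> q" "R' = R \<inter> {p'<..<q'}" "p = - q \<Longrightarrow> p' < 0 \<Longrightarrow> p' = - q'"
    using that arc' by (auto simp: signed_subarc_def)
  consider (ord) "0 < p'" | (orb) "p' = - q'" | (long) "p' < 0" "p' \<noteq> - q'" using R'(2) by linarith
  then show ?thesis
  proof cases
    case ord
    consider "0 < p" | "p = - q" | "p < 0" "p \<noteq> - q" using R(2) by linarith
    then show ?thesis
    proof cases
      case 1
      then show ?thesis using cond ord arc(2) by (intro goal1) (auto simp: arc_typeB_def)
    next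
      case 2
      then show ?thesis using cond ord arc(2) by (intro goal1) (auto simp: arc_typeB_def)
    next
      case 3
      have "q' \<le> - p \<and> {p'<..<q'} - R' = uminus ` (R \<inter> {..<0}) \<inter> {p'<..<q'} \<or>
          q' \<le> q \<and> R' = R \<inter> {0<..} \<inter> {p'<..<q'}"
        using cond ord 3 arc(2) by (simp add: arc_typeB_def)
      then show ?thesis
      proof
        assume *: "q' \<le> - p \<and> {p'<..<q'} - R' = uminus ` (R \<inter> {..<0}) \<inter> {p'<..<q'}"
        have eq: "R \<inter> {- q'<..<- p'} = uminus ` ({p'<..<q'} - R')"
          using * ord by (auto simp: mem_uminus_image)
        have "signed_arc n (- q') (- p') (R \<inter> {- q'<..<- p'})"
          using * ord arc(2) R'(1) by (intro signed_arc_restrict[OF arc(1)]) auto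
        then have "signed_subarc n (- q') (- p') p q R"
          using * ord arc(2) by (simp add: signed_subarc_def)
        then show ?thesis using ord eq by blast
      next
        assume "q' \<le> q \<and> R' = R \<inter> {0<..} \<inter> {p'<..<q'}"
        then show ?thesis using ord 3 by (intro goal1) auto
      qed
    qed
  next
    case orb
    \<comment> \<open>Exactly one of \<open>c\<close> and \<open>- c\<close> is in the right set of
      an arc through the origin, so agreement at positive points extends to negative ones.\<close>
    have opp: "c \<in> R' \<longleftrightarrow> - c \<notin> R'" if "c < 0" "- q' < c" for c
      using R'(10)[of c] R'(11)[of "- c"] orb that by auto
    consider "0 < p" | "p = - q" | "p < 0" "p \<noteq> - q" using R(2) by linarith
    then show ?thesis
    proof cases
      case 1 then show ?thesis using cond orb arc' by (simp add: arc_typeB_def)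
    next
      case 2
      have *: "q' \<le> q" "R' \<inter> {0<..} = R \<inter> {0<..} \<inter> {0<..<q'}"
        using cond orb 2 arc(2) arc'(2) by (auto simp: arc_typeB_def)
      have oppR: "c \<in> R \<longleftrightarrow> - c \<notin> R" if "c < 0" "- q < c" for c
        using R(10)[of c] R(11)[of "- c"] 2 that by auto
      have "R' = R \<inter> {p'<..<q'}"
      proof (rule int_set_eqI_by_sign)
        have "R \<inter> {p'<..<q'} \<inter> {0<..} = R \<inter> {0<..} \<inter> {0<..<q'}" using orb arc'(2) by auto
        then show "R' \<inter> {0<..} = R \<inter> {p'<..<q'} \<inter> {0<..}" using *(2) by simp
        have "c \<in> R' \<longleftrightarrow> c \<in> R \<inter> {p'<..<q'}" if "c < 0" for c
        proof (cases "- q' < c")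
          case True
          have "- c \<in> R' \<inter> {0<..} \<longleftrightarrow> - c \<in> R \<inter> {0<..} \<inter> {0<..<q'}" using *(2) by simp
          then show ?thesis using opp[of c] oppR[of c] that True *(1) orb by simp
        qed (use R'(6) orb in auto)
        then show "R' \<inter> {..<0} = R \<inter> {p'<..<q'} \<inter> {..<0}" by auto
      qed (use R(7) R'(7) in auto)
      then show ?thesis using * 2 orb by (intro goal1) auto
    next
      case 3
      have *: "q' \<le> q" "q' \<le> - p" "R' \<inter> {0<..} = R \<inter> {0<..} \<inter> {0<..<q'}"
        "{0<..<q'} - R' \<inter> {0<..} = uminus ` (R \<inter> {..<0}) \<inter> {0<..<q'}"
        using cond orb 3 arc(2) arc'(2) by (auto simp: arc_typeB_def)
      have "R' = R \<inter> {p'<..<q'}"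
      proof (rule int_set_eqI_by_sign)
        have "R \<inter> {p'<..<q'} \<inter> {0<..} = R \<inter> {0<..} \<inter> {0<..<q'}" using orb arc'(2) by auto
        then show "R' \<inter> {0<..} = R \<inter> {p'<..<q'} \<inter> {0<..}" using *(3) by simp
        have "c \<in> R' \<longleftrightarrow> c \<in> R \<inter> {p'<..<q'}" if "c < 0" for c
        proof (cases "- q' < c")
          case True
          have "- c \<in> {0<..<q'} - R' \<inter> {0<..} \<longleftrightarrow> - c \<in> uminus ` (R \<inter> {..<0}) \<inter> {0<..<q'}"
            using *(4) by simp
          then have "- c \<notin> R' \<longleftrightarrow> c \<in> R" using that True by (simp add: mem_uminus_image)
          then show ?thesis using opp[of c] that True orb by simp
        qed (use R'(6) orb in auto)
        then show "R' \<inter> {..<0} = R \<inter> {p'<..<q'} \<inter> {..<0}" by auto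
      qed (use R(7) R'(7) in auto)
      then show ?thesis using * 3 orb by (intro goal1) auto
    qed
  next
    case long
    consider "0 < p" | "p = - q" | "p < 0" "p \<noteq> - q" using R(2) by linarith
    then show ?thesis
    proof cases
      case 3
      have *: "- p' \<le> - p" "q' \<le> q" "R' \<inter> {0<..} = R \<inter> {0<..} \<inter> {0<..<q'}"
        "uminus ` (R' \<inter> {..<0}) = uminus ` (R \<inter> {..<0}) \<inter> {0<..<- p'}"
        using cond long 3 arc(2) arc'(2) by (auto simp: arc_typeB_def)
      have "R' = R \<inter> {p'<..<q'}"
      proof (rule int_set_eqI_by_sign)
        have "R \<inter> {p'<..<q'} \<inter> {0<..} = R \<inter> {0<..} \<inter> {0<..<q'}" using long arc'(2) by auto
        then show "R' \<inter> {0<..} = R \<inter> {p'<..<q'} \<inter> {0<..}" using *(3) by simp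
        have "c \<in> R' \<longleftrightarrow> c \<in> R \<inter> {p'<..<q'}" if "c < 0" for c
        proof -
          have "- c \<in> uminus ` (R' \<inter> {..<0}) \<longleftrightarrow> - c \<in> uminus ` (R \<inter> {..<0}) \<inter> {0<..<- p'}"
            using *(4) by simp
          then show ?thesis using that arc'(2) by (simp add: mem_uminus_image)
        qed
        then show "R' \<inter> {..<0} = R \<inter> {p'<..<q'} \<inter> {..<0}" by auto
      qed (use R(7) R'(7) in auto)
      then show ?thesis using * 3 by (intro goal1) auto
    qed (use cond long arc(2) arc'(2) in \<open>auto simp: arc_typeB_def\<close>)
  qed
qed

text \<open>Here \<open>q'\<close> may be negative. \<open>arc_typeB\<close> then turns the subarc
  into the upper half, where it runs along the left piece of a long arc, or along the common image
  of both halves if \<open>p = - q\<close>.\<close>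

lemma subarc_if_signed_subarc:
  assumes arc: "signed_arc n p q R" "0 < q" and sub: "signed_subarc n p' q' p q R"
  shows "subarc n (arc_typeB p' q' (R \<inter> {p'<..<q'})) (arc_typeB p q R)"
proof -
  have arc': "signed_arc n p' q' (R \<inter> {p'<..<q'})" and le: "p \<le> p'" "q' \<le> q"
    and no_long: "p = - q \<Longrightarrow> p' < 0 \<Longrightarrow> 0 < q' \<Longrightarrow> p' = - q'"
    using sub by (auto simp: signed_subarc_def)
  note R = signed_arcD[OF arc(1)] and R' = signed_arcD[OF arc']
  have oppR: "- c \<notin> R \<longleftrightarrow> c \<in> R" if "p = - q" "0 < c" "c < q" for c
    using R(10)[of c] R(11)[of c] that by auto
  have flip: "{- q'<..<- p'} - uminus ` ({p'<..<q'} - R \<inter> {p'<..<q'}) = uminus ` R \<inter> {- q'<..<- p'}"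
    by (auto simp: mem_uminus_image)
  have "subarc_cond (arc_typeB p' q' (R \<inter> {p'<..<q'})) (arc_typeB p q R)"
  proof -
    consider (pos) "0 < p'" | (neg) "p' < 0" "q' < 0" | (orb) "p' = - q'" "0 < q'"
      | (long) "p' < 0" "0 < q'" "p' \<noteq> - q'" using R'(1,2,3) by linarith
    then show ?thesis
    proof cases
      case pos
      consider "0 < p" | "p < 0" using R(2) by linarith
      then show ?thesis by cases (use pos R'(1) le arc(2) in \<open>auto simp: arc_typeB_def\<close>)
    next
      case neg
      then have "p < 0" using le by simp
      show ?thesis
      proof (cases "p = - q")
        case True
        have "uminus ` ({p'<..<q'} - R \<inter> {p'<..<q'}) = R \<inter> {0<..} \<inter> {- q'<..<- p'}"
        proof (rule Set.set_eqI)
          fix c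
          show "c \<in> uminus ` ({p'<..<q'} - R \<inter> {p'<..<q'}) \<longleftrightarrow> c \<in> R \<inter> {0<..} \<inter> {- q'<..<- p'}"
            using oppR[OF True, of c] neg le True by (auto simp: mem_uminus_image)
        qed
        then show ?thesis using neg True le arc(2) R'(1) by (simp add: arc_typeB_def)
      next
        case False
        have "uminus ` R \<inter> {- q'<..<- p'} = uminus ` (R \<inter> {..<0}) \<inter> {- q'<..<- p'}"
          using neg by (auto simp: mem_uminus_image)
        then show ?thesis using neg False le arc(2) R'(1) \<open>p < 0\<close> flip by (simp add: arc_typeB_def)
      qed
    next
      case orb
      then have "p < 0" using le by simp
      show ?thesis
      proof (cases "p = - q")
        case True
        then show ?thesis using orb le arc(2) by (auto simp: arc_typeB_def)
      next
        case False
        have "{0<..<q'} - R = uminus ` R \<inter> {0<..<q'}"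
        proof (rule Set.set_eqI)
          fix c
          show "c \<in> {0<..<q'} - R \<longleftrightarrow> c \<in> uminus ` R \<inter> {0<..<q'}"
            using R(10)[of c] R'(11)[OF orb(1), of c] by (auto simp: mem_uminus_image)
        qed
        moreover have "{0<..<q'} - R \<inter> {p'<..<q'} \<inter> {0<..} = {0<..<q'} - R" using orb by auto
        moreover have "uminus ` (R \<inter> {..<0}) \<inter> {0<..<q'} = uminus ` R \<inter> {0<..<q'}"
          by (auto simp: mem_uminus_image)
        moreover have "R \<inter> {p'<..<q'} \<inter> {0<..} = R \<inter> {0<..} \<inter> {0<..<q'}" using orb by auto
        ultimately show ?thesis using orb False le arc(2) \<open>p < 0\<close> by (simp add: arc_typeB_def)
      qed
    next
      case long
      then have "p < 0" "p \<noteq> - q" using le no_long by auto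
      moreover have "uminus ` (R \<inter> {p'<..<q'} \<inter> {..<0}) = uminus ` (R \<inter> {..<0}) \<inter> {0<..<- p'}"
        using long by (auto simp: mem_uminus_image)
      moreover have "R \<inter> {p'<..<q'} \<inter> {0<..} = R \<inter> {0<..} \<inter> {0<..<q'}" using long by auto
      moreover have "- p' \<notin> R \<inter> {0<..} \<inter> {0<..<q'}" "q' \<notin> uminus ` (R \<inter> {..<0}) \<inter> {0<..<- p'}"
        using R'(8,9) long by (auto simp: mem_uminus_image)
      ultimately show ?thesis using long le arc(2) by (simp add: arc_typeB_def)
    qed
  qed
  then show ?thesis using is_typeB_arc_arc_typeB arc arc' by (simp add: subarc_def)
qed

text \<open>Mirror images demand the same inversions up to \<open>(a, b)\<close> against
  \<open>(- b, - a)\<close>, so the same elements are above both. The half turn makes left points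
  right points, hence the complement.\<close>

lemma arc_contracted_mirror:
  assumes cong: "lattice_congruence (weak_order n) \<theta>" and "0 < p" "R \<subseteq> {p<..<q}"
  shows "arc_contracted \<theta> (- q) (- p) (uminus ` ({p<..<q} - R)) \<longleftrightarrow> arc_contracted \<theta> p q R"
proof -
  have "above_arc (- q) (- p) (uminus ` ({p<..<q} - R)) x \<longleftrightarrow> above_arc p q R x" if x: "x \<in> signed_perms n" for x
  proof -
    note inv = inversions_uminus[OF x]
    show ?thesis
    proof
      assume above: "above_arc (- q) (- p) (uminus ` ({p<..<q} - R)) x"
      show "above_arc p q R x" unfolding above_arc_def
      proof (intro ballI allI impI)
        fix a b assume "a \<in> insert p R" "b \<notin> R" "a < b" "b \<le> q"
        then have "- b \<in> insert (- q) (uminus ` ({p<..<q} - R))" "- a \<notin> uminus ` ({p<..<q} - R)"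
          "- b < - a" "- a \<le> - p" using assms(3) by (auto simp: mem_uminus_image)
        then have "(- b, - a) \<in> inversions x" using above unfolding above_arc_def by blast
        then show "(a, b) \<in> inversions x" by (simp add: inv)
      qed
    next
      assume above: "above_arc p q R x"
      show "above_arc (- q) (- p) (uminus ` ({p<..<q} - R)) x" unfolding above_arc_def
      proof (intro ballI allI impI)
        fix a b assume ab: "a \<in> insert (- q) (uminus ` ({p<..<q} - R))"
          "b \<notin> uminus ` ({p<..<q} - R)" "a < b" "b \<le> - p"
        then have "- a \<notin> R" "- b < - a" "- a \<le> q"
          using assms(3) by (auto simp: mem_uminus_image)
        moreover have "- b \<in> insert p R" using ab calculation by (cases "b = - p") (auto simp: mem_uminus_image)
        ultimately have "(- b, - a) \<in> inversions x" using above unfolding above_arc_def by blast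
        then show "(a, b) \<in> inversions x" by (simp add: inv)
      qed
    qed
  qed
  then show ?thesis using weak_congruence_mem[OF cong] unfolding arc_contracted_def by blast
qed

theorem theorem5p9:
  fixes n :: nat and j\<^sub>1 j\<^sub>2 :: "int \<Rightarrow> int"
  assumes "join_irreducible n j\<^sub>1" and "join_irreducible n j\<^sub>2"
  shows "forces n j\<^sub>1 j\<^sub>2 \<longleftrightarrow> subarc n (arc_of n j\<^sub>1) (arc_of n j\<^sub>2)"
proof -
  obtain p\<^sub>1 q\<^sub>1 R\<^sub>1 where 1: "signed_arc n p\<^sub>1 q\<^sub>1 R\<^sub>1" "0 < q\<^sub>1" "inversions j\<^sub>1 = arc_inversions p\<^sub>1 q\<^sub>1 R\<^sub>1"
    using join_irreducible_arc[OF assms(1)] by blast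
  obtain p\<^sub>2 q\<^sub>2 R\<^sub>2 where 2: "signed_arc n p\<^sub>2 q\<^sub>2 R\<^sub>2" "0 < q\<^sub>2" "inversions j\<^sub>2 = arc_inversions p\<^sub>2 q\<^sub>2 R\<^sub>2"
    using join_irreducible_arc[OF assms(2)] by blast
  note contracts1 = contracts_iff_arc_contracted[OF assms(1) 1(1,3)]
    and contracts2 = contracts_iff_arc_contracted[OF assms(2) 2(1,3)]
    and arc_of1 = arc_of_eq_arc_typeB[OF assms(1) 1(1,3)]
    and arc_of2 = arc_of_eq_arc_typeB[OF assms(2) 2(1,3)]
  show ?thesis
  proof
    assume "subarc n (arc_of n j\<^sub>1) (arc_of n j\<^sub>2)"
    then have "signed_subarc n p\<^sub>1 q\<^sub>1 p\<^sub>2 q\<^sub>2 R\<^sub>2 \<and> R\<^sub>1 = R\<^sub>2 \<inter> {p\<^sub>1<..<q\<^sub>1} \<or>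
        0 < p\<^sub>1 \<and> signed_subarc n (- q\<^sub>1) (- p\<^sub>1) p\<^sub>2 q\<^sub>2 R\<^sub>2 \<and>
          R\<^sub>2 \<inter> {- q\<^sub>1<..<- p\<^sub>1} = uminus ` ({p\<^sub>1<..<q\<^sub>1} - R\<^sub>1)"
      using signed_subarc_if_subarc[OF 1(1,2) 2(1,2)] arc_of1 arc_of2 by simp
    then have "arc_forces n p\<^sub>1 q\<^sub>1 R\<^sub>1 p\<^sub>2 q\<^sub>2 R\<^sub>2"
    proof
      assume "signed_subarc n p\<^sub>1 q\<^sub>1 p\<^sub>2 q\<^sub>2 R\<^sub>2 \<and> R\<^sub>1 = R\<^sub>2 \<inter> {p\<^sub>1<..<q\<^sub>1}"
      then show ?thesis using arc_forces_if_signed_subarc[OF 2(1)] by blast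
    next
      assume *: "0 < p\<^sub>1 \<and> signed_subarc n (- q\<^sub>1) (- p\<^sub>1) p\<^sub>2 q\<^sub>2 R\<^sub>2 \<and>
          R\<^sub>2 \<inter> {- q\<^sub>1<..<- p\<^sub>1} = uminus ` ({p\<^sub>1<..<q\<^sub>1} - R\<^sub>1)"
      then have "arc_forces n (- q\<^sub>1) (- p\<^sub>1) (uminus ` ({p\<^sub>1<..<q\<^sub>1} - R\<^sub>1)) p\<^sub>2 q\<^sub>2 R\<^sub>2"
        using arc_forces_if_signed_subarc[OF 2(1), of "- q\<^sub>1" "- p\<^sub>1"] by simp
      then show ?thesis
        using arc_contracted_mirror * signed_arcD(6)[OF 1(1)] by (auto simp: arc_forces_def)
    qed
    then show "forces n j\<^sub>1 j\<^sub>2" using contracts1 contracts2 by (auto simp: forces_def arc_forces_def)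
  next
    assume forces: "forces n j\<^sub>1 j\<^sub>2"
    \<comment> \<open>This congruence never identifies elements that the second arc separates, as
      that arc is a subarc of itself. So it leaves the second element uncontracted, and by forcing
      also the first.\<close>
    let ?\<theta> = "arc_congruence n p\<^sub>2 q\<^sub>2 R\<^sub>2"
    note cong = lattice_congruence_arc_congruence[OF 2(1)]
    have "\<not> arc_contracted ?\<theta> p\<^sub>2 q\<^sub>2 R\<^sub>2"
    proof -
      have "R\<^sub>2 \<inter> {p\<^sub>2<..<q\<^sub>2} = R\<^sub>2" using signed_arcD(6)[OF 2(1)] by auto
      then show ?thesis using signed_subarc_refl[OF 2(1)]
        by (fastforce simp: arc_contracted_def arc_congruence_def)
    qed
    then have not: "\<not> contracts n ?\<theta> j\<^sub>1"
      using forces cong contracts2 by (auto simp: forces_def)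
    have cover: "weak_covered n (lower_cover n j\<^sub>1) j\<^sub>1" using weak_covered_lower_cover[OF assms(1)] .
    then have mem: "j\<^sub>1 \<in> signed_perms n" "lower_cover n j\<^sub>1 \<in> signed_perms n"
      and le: "weak_le (lower_cover n j\<^sub>1) j\<^sub>1"
      using weak_covered_mem weak_covered_inversions[OF cover] by (auto simp: weak_le_def)
    obtain p' q' where sub: "signed_subarc n p' q' p\<^sub>2 q\<^sub>2 R\<^sub>2"
      and above: "above_arc p' q' (R\<^sub>2 \<inter> {p'<..<q'}) j\<^sub>1"
        "\<not> above_arc p' q' (R\<^sub>2 \<inter> {p'<..<q'}) (lower_cover n j\<^sub>1)"
      using not mem above_arc_mono[OF le] unfolding contracts_def arc_congruence_def by blast
    have arc': "signed_arc n p' q' (R\<^sub>2 \<inter> {p'<..<q'})" using sub by (simp add: signed_subarc_def)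
    obtain j where j: "j \<in> signed_perms n" "inversions j = arc_inversions p' q' (R\<^sub>2 \<inter> {p'<..<q'})"
      "\<And>x. x \<in> signed_perms n \<Longrightarrow> above_arc p' q' (R\<^sub>2 \<inter> {p'<..<q'}) x \<longleftrightarrow> weak_le j x"
      using join_irreducible_of_arc[OF arc'] by metis
    \<comment> \<open>The join-irreducible of the separating subarc is below
      \<open>j\<^sub>1\<close> but not below its unique lower cover.\<close>
    have "j = j\<^sub>1" using le_lower_cover[OF assms(1) j(1)] j(3) above mem by blast
    then have "arc_of n j\<^sub>1 = arc_typeB p' q' (R\<^sub>2 \<inter> {p'<..<q'})"
      using arc_of_eq_arc_typeB[OF assms(1) arc'] j(2) by blast
    then show "subarc n (arc_of n j\<^sub>1) (arc_of n j\<^sub>2)"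
      using subarc_if_signed_subarc[OF 2(1,2) sub] arc_of2 by simp
  qed
qed

end
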